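(* Let $\lambda=(\lambda_1,\ldots,\lambda_k=1)$ be a partition of $n$ (so its last part $\lambda_k$ equals $1$) and let $\sigma \in \mathfrak S_n$ have cycle type $\lambda$. Then the character of $V_{(n),j}$ evaluated at $\sigma$ is the coefficient of $t^j$ in $$tA_{k-1}(t)\prod_{i=1}^{k}[\lambda_i]_t.$$
   Context: For $n\ge1$, $\mathfrak S_n$ is the symmetric group on $[n]=\{1,\dots,n\}$, and $\sigma\in\mathfrak S_n$ is written $\sigma_1\cdots\sigma_n$ with $\sigma_i=\sigma(i)$. $\mathrm{EXC}(\sigma)=\{i\in[n-1]:\sigma_i>i\}$ and $\mathrm{exc}(\sigma)=|\mathrm{EXC}(\sigma)|$. Totally order the alphabet $[n]\cup\{\bar1,\dots,\bar n\}$ by $\bar1<\cdots<\bar n<1<\cdots<n$. Let $\bar\sigma$ be the word obtained from $\sigma_1\cdots\sigma_n$ by replacing $\sigma_i$ with $\overline{\sigma_i}$ for each $i\in\mathrm{EXC}(\sigma)$, and let $\mathrm{DEX}(\sigma)$ be the set of $i\in[n-1]$ such that the $i$th letter of $\bar\sigma$ is larger than the $(i+1)$st. For $S\subseteq[n-1]$, $F_{S,n}(\mathbf x)=\sum x_{i_1}\cdots x_{i_n}$, summed over all $i_1\ge\cdots\ge i_n\ge1$ with $i_j>i_{j+1}$ whenever $j\in S$. $Q_{(n),j}=\sum F_{\mathrm{DEX}(\sigma),n}$, summed over all $n$-cycles $\sigma\in\mathfrak S_n$ with $\mathrm{exc}(\sigma)=j$; it is known to be a symmetric function (with integer coefficients).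 The Frobenius characteristic of a virtual representation $V$ of $\mathfrak S_n$ is $\mathrm{ch}\,V=\sum_{\mu\vdash n}z_\mu^{-1}\chi^V_\mu p_\mu$, where $\chi^V_\mu$ is the value of the character of $V$ on the conjugacy class of cycle type $\mu$, $p_\mu=p_{\mu_1}p_{\mu_2}\cdots$ with $p_m=\sum_i x_i^m$, and $z_\mu=\prod_i i^{m_i}m_i!$ if $\mu$ has $m_i$ parts of size $i$. $V_{(n),j}$ is the virtual representation of $\mathfrak S_n$ with Frobenius characteristic $Q_{(n),j}$, where $(n)$ is the partition with single part $n$. $A_m(t)=\sum_{\sigma\in\mathfrak S_m}t^{\mathrm{exc}(\sigma)}$ is the Eulerian polynomial ($A_0(t)=1$), and $[m]_t=1+t+\cdots+t^{m-1}$.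
   Formalization: The case n = 1 is excluded (n ≥ 2 is assumed): for λ = (1) and j = 0 the character value is 1, but the coefficient of t^0 in t·A_0(t)·[1]_t = t is 0, so the formula fails there. *)

theory Defs
  imports
    "HOL-Algebra.Sym_Groups"
    "HOL-Combinatorics.Orbits"
    "HOL-Computational_Algebra.Polynomial"
    "HOL-Library.FuncSet"
    "HOL-Library.Multiset"
    "HOL-Library.Poly_Mapping"
    "Jordan_Normal_Form.Matrix"
begin

section \<open>Permutation statistics\<close>

text \<open>A permutation of \<open>[n]\<close> is a function \<open>\<sigma> :: nat \<Rightarrow> nat\<close> with \<open>\<sigma> permutes {1..n}\<close>.
  The index set \<open>[n-1]\<close> is \<open>{1..<n}\<close>.\<close>

definition EXC :: "nat \<Rightarrow> (nat \<Rightarrow> nat) \<Rightarrow> nat set" where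
  "EXC n \<sigma> = {i \<in> {1..<n}. \<sigma> i > i}"

definition exc :: "nat \<Rightarrow> (nat \<Rightarrow> nat) \<Rightarrow> nat" where
  "exc n \<sigma> = card (EXC n \<sigma>)"

datatype letter = Bar nat | Plain nat

text \<open>The order \<open>Bar 1 < \<dots> < Bar n < Plain 1 < \<dots> < Plain n\<close>.\<close>

fun letter_less :: "letter \<Rightarrow> letter \<Rightarrow> bool" where
  "letter_less (Bar a) (Bar b) \<longleftrightarrow> a < b"
| "letter_less (Bar a) (Plain b) \<longleftrightarrow> True"
| "letter_less (Plain a) (Bar b) \<longleftrightarrow> False"
| "letter_less (Plain a) (Plain b) \<longleftrightarrow> a < b"

definition bar_word :: "nat \<Rightarrow> (nat \<Rightarrow> nat) \<Rightarrow> nat \<Rightarrow> letter" where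
  "bar_word n \<sigma> i = (if i \<in> EXC n \<sigma> then Bar (\<sigma> i) else Plain (\<sigma> i))"

definition DEX :: "nat \<Rightarrow> (nat \<Rightarrow> nat) \<Rightarrow> nat set" where
  "DEX n \<sigma> = {i \<in> {1..<n}. letter_less (bar_word n \<sigma> (Suc i)) (bar_word n \<sigma> i)}"

definition cycle_type :: "nat \<Rightarrow> (nat \<Rightarrow> nat) \<Rightarrow> nat multiset" where
  "cycle_type n \<sigma> = image_mset card (mset_set (Orbits.orbit \<sigma> ` {1..n}))"

definition is_partition :: "nat \<Rightarrow> nat list \<Rightarrow> bool" where
  "is_partition n \<mu> \<longleftrightarrow> sorted_wrt (\<ge>) \<mu> \<and> (\<forall>i\<in>set \<mu>. i \<ge> 1) \<and> sum_list \<mu> = n"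

definition eulerian_poly :: "nat \<Rightarrow> int poly" where
  "eulerian_poly m = (\<Sum>\<sigma> | \<sigma> permutes {1..m}. monom 1 (exc m \<sigma>))"

definition q_int :: "nat \<Rightarrow> int poly" where
  "q_int m = (\<Sum>i<m. monom 1 i)"


section \<open>Formal power series in infinitely many variables\<close>

text \<open>A formal power series in \<open>x\<^sub>1, x\<^sub>2, \<dots>\<close> is given by its coefficients, indexed by
  exponent vectors of finite support. The variable index \<open>0\<close> does not occur in the
  series considered here.\<close>

type_synonym series = "(nat \<Rightarrow>\<^sub>0 nat) \<Rightarrow> complex"

definition series_one :: series where
  "series_one e = (if e = 0 then 1 else 0)"

definition series_mult :: "series \<Rightarrow> series \<Rightarrow> series" where
  "series_mult f g e = (\<Sum>(a, b) | a + b = e. f a * g b)"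

definition power_sum :: "nat \<Rightarrow> series" where
  "power_sum m e = of_nat (card {i. i \<ge> 1 \<and> Poly_Mapping.single i m = e})"

definition power_sum_partition :: "nat list \<Rightarrow> series" where
  "power_sum_partition \<mu> = foldr (\<lambda>m. series_mult (power_sum m)) \<mu> series_one"

text \<open>The coefficient of \<open>x^e\<close> in \<open>F\<^sub>S\<^sub>,\<^sub>n\<close> is the number of admissible index
  sequences \<open>i\<^sub>1, \<dots>, i\<^sub>n\<close> whose monomial \<open>x\<^sub>i\<^sub>1 \<cdots> x\<^sub>i\<^sub>n\<close> is \<open>x^e\<close>.\<close>

definition fund_seqs :: "nat set \<Rightarrow> nat \<Rightarrow> (nat \<Rightarrow> nat) set" where
  "fund_seqs S n = {s \<in> {1..n} \<rightarrow>\<^sub>E {1..}.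
     (\<forall>j\<in>{1..<n}. s j \<ge> s (Suc j)) \<and> (\<forall>j\<in>S. s j > s (Suc j))}"

definition fund_qsym :: "nat set \<Rightarrow> nat \<Rightarrow> series" where
  "fund_qsym S n e =
     of_nat (card {s \<in> fund_seqs S n. (\<Sum>j=1..n. Poly_Mapping.single (s j) 1) = e})"

definition Q_cycle :: "nat \<Rightarrow> nat \<Rightarrow> series" where
  "Q_cycle n j e =
     (\<Sum>\<sigma> | \<sigma> permutes {1..n} \<and> cyclic_on \<sigma> {1..n} \<and> exc n \<sigma> = j. fund_qsym (DEX n \<sigma>) n e)"

text \<open>The sets indexing the sums and cardinalities above are finite.\<close>

lemma finite_series_mult_index: "finite {(a, b). a + b = (e :: nat \<Rightarrow>\<^sub>0 nat)}"
proof -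
  let ?lk = "Poly_Mapping.lookup :: (nat \<Rightarrow>\<^sub>0 nat) \<Rightarrow> nat \<Rightarrow> nat"
  define N where "N = Max (range (?lk e))"
  define B where "B = {f. \<forall>x. (x \<in> Poly_Mapping.keys e \<longrightarrow> f x \<in> {..N}) \<and>
                              (x \<notin> Poly_Mapping.keys e \<longrightarrow> f x = 0)}"
  have "finite B"
    unfolding B_def by (rule finite_set_of_finite_funs) auto
  have fin: "finite (range (?lk e))"
    by (rule finite_subset[of _ "insert 0 (?lk e ` Poly_Mapping.keys e)"])
       (auto simp: in_keys_iff)
  have "(a, b) \<in> (\<lambda>f. (Abs_poly_mapping f, e - Abs_poly_mapping f)) ` B" if "a + b = e" for a b
  proof (rule image_eqI)
    have ab: "?lk e x = ?lk a x + ?lk b x" for x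
      using that by (auto simp: lookup_add)
    have "?lk a x \<le> N" for x
      using Max_ge[OF fin, OF rangeI, of x] ab[of x] unfolding N_def by linarith
    moreover have "?lk a x = 0" if "x \<notin> Poly_Mapping.keys e" for x
      using that ab[of x] by (simp add: in_keys_iff)
    ultimately show "?lk a \<in> B" by (simp add: B_def)
    show "(a, b) = (Abs_poly_mapping (?lk a), e - Abs_poly_mapping (?lk a))"
      unfolding lookup_inverse that[symmetric] by (simp only: add_diff_cancel_left')
  qed
  hence "{(a, b). a + b = e} \<subseteq> (\<lambda>f. (Abs_poly_mapping f, e - Abs_poly_mapping f)) ` B"
    by (intro subsetI) (elim CollectE case_prodE, simp only:)
  thus ?thesis
    using finite_imageI[OF \<open>finite B\<close>] by (rule finite_subset)
qed

lemma finite_power_sum_index: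
  assumes "(m :: nat) \<ge> 1"
  shows "finite {i. i \<ge> 1 \<and> Poly_Mapping.single i m = e}"
proof (rule finite_subset)
  show "{i. i \<ge> 1 \<and> Poly_Mapping.single i m = e} \<subseteq> Poly_Mapping.keys e"
    using assms by auto
qed simp

lemma finite_fund_qsym_index:
  "finite {s \<in> fund_seqs S n. (\<Sum>j=1..n. Poly_Mapping.single (s j) 1) = (e :: nat \<Rightarrow>\<^sub>0 nat)}"
proof (rule finite_subset)
  show "{s \<in> fund_seqs S n. (\<Sum>j=1..n. Poly_Mapping.single (s j) 1) = e} \<subseteq> {1..n} \<rightarrow>\<^sub>E Poly_Mapping.keys e"
  proof
    fix s assume "s \<in> {s \<in> fund_seqs S n. (\<Sum>j=1..n. Poly_Mapping.single (s j) 1) = e}"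
    hence s: "s \<in> extensional {1..n}" and e: "(\<Sum>j=1..n. Poly_Mapping.single (s j) 1) = e"
      by (auto simp: fund_seqs_def PiE_def)
    have "s i \<in> Poly_Mapping.keys e" if i: "i \<in> {1..n}" for i
    proof -
      have "Poly_Mapping.lookup (Poly_Mapping.single (s i) (1::nat)) (s i)
              \<le> (\<Sum>j=1..n. Poly_Mapping.lookup (Poly_Mapping.single (s j) (1::nat)) (s i))"
        by (rule member_le_sum[where f = "\<lambda>j. Poly_Mapping.lookup (Poly_Mapping.single (s j) (1::nat)) (s i)"])
           (use i in auto)
      hence "Poly_Mapping.lookup e (s i) \<ge> 1" by (simp flip: e add: lookup_sum)
      thus ?thesis by (simp add: in_keys_iff)
    qed
    thus "s \<in> {1..n} \<rightarrow>\<^sub>E Poly_Mapping.keys e" using s by (auto simp: PiE_def)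
  qed
qed (auto intro: finite_PiE)

lemma finite_partitions: "finite {\<mu>. is_partition n \<mu>}"
proof (rule finite_subset)
  have "length \<mu> \<le> sum_list \<mu>" if "\<forall>i\<in>set \<mu>. i \<ge> (1::nat)" for \<mu>
    using that by (induction \<mu>) auto
  thus "{\<mu>. is_partition n \<mu>} \<subseteq> {\<mu>. set \<mu> \<subseteq> {..n} \<and> length \<mu> \<le> n}"
    by (auto simp: is_partition_def intro: member_le_sum_list)
qed (auto intro: finite_lists_length_le)


section \<open>Virtual representations and the Frobenius characteristic\<close>

definition mat_trace :: "'a :: comm_monoid_add mat \<Rightarrow> 'a" where
  "mat_trace A = (\<Sum>i<dim_row A. A $$ (i, i))"

text \<open>Finite-dimensional complex matrix representations, i.e. homomorphisms from the
  symmetric group to some \<open>GL\<^sub>d\<close> over the complex numbers (\<open>d = 0\<close> is the zero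
  representation).\<close>

type_synonym rep = "(nat \<Rightarrow> nat) \<Rightarrow> complex mat"

definition is_rep :: "nat \<Rightarrow> rep \<Rightarrow> bool" where
  "is_rep n \<rho> \<longleftrightarrow> (\<exists>d. \<rho> \<in> hom (sym_group n) (units_of (ring_mat TYPE(complex) d ())))"

text \<open>A virtual representation is a formal difference of two representations, given here
  by a pair representing it.\<close>

type_synonym virtual_rep = "rep \<times> rep"

definition is_virtual_rep :: "nat \<Rightarrow> virtual_rep \<Rightarrow> bool" where
  "is_virtual_rep n V \<longleftrightarrow> is_rep n (fst V) \<and> is_rep n (snd V)"

definition character :: "virtual_rep \<Rightarrow> (nat \<Rightarrow> nat) \<Rightarrow> complex" where
  "character V \<sigma> = mat_trace (fst V \<sigma>) - mat_trace (snd V \<sigma>)"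

text \<open>The value on the conjugacy class of cycle type \<open>\<mu>\<close> is read off at an arbitrary
  representative, a character being a class function.\<close>

definition character_at_type :: "nat \<Rightarrow> virtual_rep \<Rightarrow> nat list \<Rightarrow> complex" where
  "character_at_type n V \<mu> =
     character V (SOME \<sigma>. \<sigma> permutes {1..n} \<and> cycle_type n \<sigma> = mset \<mu>)"

definition z_partition :: "nat list \<Rightarrow> nat" where
  "z_partition \<mu> = (\<Prod>i\<in>set \<mu>. i ^ count_list \<mu> i * fact (count_list \<mu> i))"

definition frobenius_ch :: "nat \<Rightarrow> virtual_rep \<Rightarrow> series" where
  "frobenius_ch n V e =
     (\<Sum>\<mu> | is_partition n \<mu>.
        inverse (of_nat (z_partition \<mu>)) * character_at_type n V \<mu> * power_sum_partition \<mu> e)"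

end

theory Submission
  imports
    Defs
    "HOL-Combinatorics.Multiset_Permutations"
    "HOL-Computational_Algebra.Polynomial_FPS"
    "HOL-Library.List_Lexorder"
begin

text \<open>Expand the Frobenius characteristic in power sums.  If \<open>M\<close> is the largest index that occurs,
then \<open>p\<^sub>l\<close> splits as \<open>p\<^sub>l\<close> of the smaller variables plus the \<open>l\<close>-th power of \<open>x\<^sub>M\<close>, so extracting
the coefficient that is linear in \<open>x\<^sub>M\<close> acts as \<open>\<partial>/\<partial>p\<^sub>1\<close>: it kills \<open>p\<^sub>\<mu>\<close> unless \<open>\<mu> = \<nu> @ [1]\<close>, and
then \<open>z\<^sub>\<mu>\<^sup>-\<^sup>1 p\<^sub>\<mu>\<close> turns into \<open>z\<^sub>\<nu>\<^sup>-\<^sup>1 p\<^sub>\<nu>\<close>.  Exactly the character values at classes with a fixed point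
survive (\<open>coeff_frobenius_ch\<close>), and they can be read off because power sums are linearly independent
(\<open>power_sums_linearly_independent\<close>).

On the quasisymmetric side the same extraction restricts to pairs of an \<open>n\<close>-cycle \<open>\<sigma>\<close> and an
admissible sequence \<open>s\<close> with a unique largest entry, which is then \<open>s 1 = M\<close>.  Reading
\<open>s (\<sigma> 1), s (\<sigma> (\<sigma> 1)), \<dots>\<close> and barring the excedances gives a word of length \<open>n - 1\<close> in which every
barred letter is followed by a weakly smaller one and every other letter by a weakly larger one,
the last letter being unbarred.  This is the bijection of Gessel and Reutenauer; since \<open>M\<close>
occurs once, the circular words that it involves in general can be cut open there, no primitivity
condition is left, and the inverse ranks the positions by their suffixes
(\<open>Q_cycle_eq_coloured_words\<close>).

A word without its bars carries the weight \<open>\<Prod> step_poly\<close>, where a step up, a step down and a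
plateau weigh \<open>1\<close>, \<open>t\<close> and \<open>1 + t\<close>.  Summing over all words gives
\<open>(1 - t) E / (1 - t E)\<close> with \<open>E = \<Prod> (1 - t x\<^sub>i z) / (1 - x\<^sub>i z)\<close> (\<open>word_series_exp\<close>).  As
\<open>log E = \<Sum> (1 - t^l) p\<^sub>l z^l / l\<close> and \<open>(1 - t) e^y / (1 - t e^y)\<close> generates the Eulerian
polynomials (\<open>eulerian_egf_identity\<close>), the part of \<open>\<nu>\<close> in this series is
\<open>z\<^sub>\<nu>\<^sup>-\<^sup>1 A\<^sub>k(t) \<Prod> [\<nu>\<^sub>i]\<^sub>t p\<^sub>\<nu>\<close> with \<open>k\<close> the number of parts of \<open>\<nu>\<close> (\<open>sum_word_poly_coeff\<close>).  The remaining
factor \<open>t\<close> stands for the letter \<open>M\<close>, which is always an excedance.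

The generating functions are treated as formal power series in \<open>z\<close> alone, for numerical values of
the variables \<open>x\<^sub>i\<close> and of \<open>t\<close>; coefficients are recovered afterwards, because the two sides are
polynomials that agree at sufficiently many points.\<close>

section \<open>Conjugate permutations and class functions\<close>

lemma bij_betw_if_image_mset_eq:
  assumes "finite A" "finite B" "image_mset f (mset_set A) = image_mset h (mset_set B)"
  shows "\<exists>g. bij_betw g A B \<and> (\<forall>a\<in>A. h (g a) = f a)"
  using assms
proof (induction A arbitrary: B rule: finite_induct)
  case (insert a A)
  have "f a \<in># image_mset h (mset_set B)"
    unfolding insert.prems(2)[symmetric] using insert.hyps by simp
  then obtain b where b: "b \<in> B" "h b = f a" using insert.prems(1) by auto
  have "mset_set B = add_mset b (mset_set (B - {b}))"
    using b insert.prems(1) by (metis mset_set.remove)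
  hence "image_mset f (mset_set A) = image_mset h (mset_set (B - {b}))"
    using insert.prems(2) insert.hyps b by simp
  with insert.IH insert.prems(1) obtain g where
    g: "bij_betw g A (B - {b})" "\<forall>a\<in>A. h (g a) = f a" by (meson finite_Diff)
  have "bij_betw (g(a := b)) A (B - {b})"
    using g(1) insert.hyps by (subst bij_betw_cong[where g = g]) auto
  hence "bij_betw (g(a := b)) (insert a A) (insert b (B - {b}))"
    using insert.hyps by (subst insert_is_Un, subst (2) insert_is_Un)
      (intro bij_betw_combine, auto)
  hence "bij_betw (g(a := b)) (insert a A) B" using b by (simp add: insert_absorb)
  moreover have "\<forall>x\<in>insert a A. h ((g(a := b)) x) = f x" using g(2) b insert.hyps by auto
  ultimately show ?case by blast
qed (auto simp: mset_set_empty_iff bij_betw_def)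

lemma funpow_eq_iff_mod_card_orbit:
  assumes "permutation f"
  shows "(f ^^ k) x = (f ^^ l) x \<longleftrightarrow> k mod card (orbit f x) = l mod card (orbit f x)"
proof -
  let ?d = "funpow_dist1 f x x"
  have x: "x \<in> orbit f x" using assms by (rule permutation_self_in_orbit)
  have inj: "inj_on (\<lambda>n. (f ^^ n) x) {0..<?d}" by (rule inj_on_funpow_dist1[OF x])
  have "orbit f x = (\<lambda>n. (f ^^ n) x) ` {0..<?d}" by (rule orbit_conv_funpow_dist1[OF x])
  hence c: "card (orbit f x) = ?d" using card_image[OF inj] by simp
  have "(f ^^ ?d) x = x" by (rule funpow_dist1_prop[OF x])
  hence m: "(f ^^ n) x = (f ^^ (n mod ?d)) x" for n by (simp add: funpow_mod_eq)
  have "(f ^^ k) x = (f ^^ l) x \<longleftrightarrow> (f ^^ (k mod ?d)) x = (f ^^ (l mod ?d)) x"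
    using m[of k] m[of l] by simp
  also have "\<dots> \<longleftrightarrow> k mod ?d = l mod ?d"
    using inj_onD[OF inj, of "k mod ?d" "l mod ?d"] by auto
  finally show ?thesis unfolding c .
qed

text \<open>Match the orbits of \<open>\<sigma>\<close> with orbits of \<open>\<tau>\<close> of the same size and choose a base point in each.
Sending the \<open>k\<close>-th iterate of a base point to the \<open>k\<close>-th iterate of its partner is well defined
and injective, because on both sides iterates coincide exactly when the exponents agree modulo the
common size of the orbits.\<close>

lemma conjugate_if_orbit_cards_eq:
  assumes S: "finite S" and \<sigma>: "\<sigma> permutes S" and \<tau>: "\<tau> permutes S"
    and eq: "image_mset card (mset_set (orbit \<sigma> ` S)) = image_mset card (mset_set (orbit \<tau> ` S))"
  shows "\<exists>\<pi>. \<pi> permutes S \<and> \<tau> \<circ> \<pi> = \<pi> \<circ> \<sigma>"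
proof -
  obtain g where g: "bij_betw g (orbit \<sigma> ` S) (orbit \<tau> ` S)"
      and gc: "\<And>O'. O' \<in> orbit \<sigma> ` S \<Longrightarrow> card (g O') = card O'"
    using bij_betw_if_image_mset_eq[OF _ _ eq] S by auto
  have perm: "permutation \<sigma>" "permutation \<tau>"
    using S \<sigma> \<tau> by (auto simp: permutation_permutes)
  have orb: "orbit p x = orbit p y" if "permutation p" "x \<in> orbit p y" for p :: "'a \<Rightarrow> 'a" and x y
    by (rule orbit_cyclic_eq3[OF cyclic_on_orbit'[OF that(1)] that(2)])
  define r where "r x = (SOME y. y \<in> orbit \<sigma> x)" for x
  have r: "r x \<in> orbit \<sigma> x" for x
    unfolding r_def using permutation_self_in_orbit[OF perm(1)] by (rule someI)
  have r_eq: "orbit \<sigma> (r x) = orbit \<sigma> x" for x using orb[OF perm(1) r] .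
  have r_step: "r (\<sigma> x) = r x" for x
    unfolding r_def by (simp add: permutation_orbit_step[OF perm(1)])
  define r' where "r' x = (SOME y. y \<in> g (orbit \<sigma> x))" for x
  have r': "r' x \<in> g (orbit \<sigma> x)" "orbit \<tau> (r' x) = g (orbit \<sigma> x)" "r' x \<in> S" if "x \<in> S" for x
  proof -
    have "g (orbit \<sigma> x) \<in> orbit \<tau> ` S" using g that by (auto simp: bij_betw_def)
    then obtain z where z: "z \<in> S" "g (orbit \<sigma> x) = orbit \<tau> z" by auto
    have "z \<in> g (orbit \<sigma> x)" unfolding z using permutation_self_in_orbit[OF perm(2)] .
    thus *: "r' x \<in> g (orbit \<sigma> x)" unfolding r'_def by (rule someI)
    thus "orbit \<tau> (r' x) = g (orbit \<sigma> x)" unfolding z by (rule orb[OF perm(2)])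
    show "r' x \<in> S" using * z permutes_orbit_subset[OF \<tau>] by auto
  qed
  have r'_step: "r' (\<sigma> x) = r' x" for x
    unfolding r'_def by (simp add: permutation_orbit_step[OF perm(1)])
  have card_eq: "card (orbit \<tau> (r' x)) = card (orbit \<sigma> (r x))" if "x \<in> S" for x
    using r'[OF that] gc[of "orbit \<sigma> x"] that by (simp add: r_eq)
  define k where "k x = (SOME n. (\<sigma> ^^ n) (r x) = x)" for x
  have k: "(\<sigma> ^^ k x) (r x) = x" for x
  proof -
    have "x \<in> orbit \<sigma> (r x)" using permutation_self_in_orbit[OF perm(1)] by (simp add: r_eq)
    hence "\<exists>n. (\<sigma> ^^ n) (r x) = x" unfolding orbit_altdef mem_Collect_eq by metis
    thus ?thesis unfolding k_def by (rule someI_ex)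
  qed
  define \<pi> where "\<pi> x = (if x \<in> S then (\<tau> ^^ k x) (r' x) else x)" for x
  have \<pi>_orb: "\<pi> x \<in> orbit \<tau> (r' x)" if "x \<in> S" for x
    using that perm(2) by (auto simp: \<pi>_def orbit_altdef_permutation)
  have "inj_on \<pi> S"
  proof (rule inj_onI)
    fix x y assume xy: "x \<in> S" "y \<in> S" "\<pi> x = \<pi> y"
    have "orbit \<tau> (r' x) = orbit \<tau> (r' y)"
      using orb[OF perm(2) \<pi>_orb[OF xy(1)]] orb[OF perm(2) \<pi>_orb[OF xy(2)]] xy(3) by simp
    hence "g (orbit \<sigma> x) = g (orbit \<sigma> y)" using r' xy by simp
    hence o: "orbit \<sigma> x = orbit \<sigma> y" using g xy by (auto simp: bij_betw_def dest: inj_onD)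
    hence rr: "r x = r y" "r' x = r' y" by (simp_all add: r_def r'_def)
    have "(\<tau> ^^ k x) (r' x) = (\<tau> ^^ k y) (r' x)" using xy rr by (simp add: \<pi>_def)
    hence "(\<sigma> ^^ k x) (r x) = (\<sigma> ^^ k y) (r x)"
      using funpow_eq_iff_mod_card_orbit perm card_eq[OF xy(1)] by metis
    thus "x = y" by (metis k rr(1))
  qed
  moreover have "\<pi> ` S \<subseteq> S"
  proof (rule image_subsetI)
    fix x assume "x \<in> S"
    thus "\<pi> x \<in> S" using \<pi>_orb[of x] r'(3)[of x] permutes_orbit_subset[OF \<tau>, of "r' x"] by auto
  qed
  ultimately have "bij_betw \<pi> S S" using S by (simp add: bij_betw_def endo_inj_surj)
  hence "\<pi> permutes S" by (rule bij_imp_permutes) (simp add: \<pi>_def)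
  moreover have "\<tau> (\<pi> x) = \<pi> (\<sigma> x)" for x
  proof (cases "x \<in> S")
    case True
    have "(\<sigma> ^^ k (\<sigma> x)) (r x) = (\<sigma> ^^ Suc (k x)) (r x)" using k[of "\<sigma> x"] k[of x] by (simp add: r_step)
    hence "(\<tau> ^^ k (\<sigma> x)) (r' x) = (\<tau> ^^ Suc (k x)) (r' x)"
      using funpow_eq_iff_mod_card_orbit perm card_eq[OF True] by metis
    thus ?thesis using True permutes_in_image[OF \<sigma>] by (simp add: \<pi>_def r'_step)
  next
    case False
    thus ?thesis using \<sigma> \<tau> by (simp add: \<pi>_def permutes_not_in)
  qed
  ultimately show ?thesis by (intro exI[of _ \<pi>]) auto
qed

lemma mat_trace_mult_commute:
  fixes A B :: "'a :: comm_semiring_0 mat"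
  assumes "A \<in> carrier_mat d d" "B \<in> carrier_mat d d"
  shows "mat_trace (A * B) = mat_trace (B * A)"
proof -
  have "mat_trace (A * B) = (\<Sum>i<d. \<Sum>k<d. A $$ (i, k) * B $$ (k, i))"
    using assms by (simp add: mat_trace_def scalar_prod_def atLeast0LessThan)
  also have "\<dots> = (\<Sum>k<d. \<Sum>i<d. B $$ (k, i) * A $$ (i, k))"
    by (subst sum.swap) (simp add: mult.commute)
  also have "\<dots> = mat_trace (B * A)"
    using assms by (simp add: mat_trace_def scalar_prod_def atLeast0LessThan)
  finally show ?thesis .
qed

lemma mat_trace_rep_conjugate:
  assumes \<rho>: "is_rep n \<rho>" and \<sigma>: "\<sigma> permutes {1..n}" and \<pi>: "\<pi> permutes {1..n}"
    and conj: "\<tau> \<circ> \<pi> = \<pi> \<circ> \<sigma>"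
  shows "mat_trace (\<rho> \<tau>) = mat_trace (\<rho> \<sigma>)"
proof -
  obtain d where h: "\<rho> \<in> hom (sym_group n) (units_of (ring_mat TYPE(complex) d ()))"
    using \<rho> unfolding is_rep_def by blast
  have mult: "\<rho> (p \<circ> q) = \<rho> p * \<rho> q" if "p permutes {1..n}" "q permutes {1..n}" for p q
    using hom_mult[OF h, of p q] that by (simp add: sym_group_def units_of_def ring_mat_def)
  have car: "\<rho> p \<in> carrier_mat d d" if "p permutes {1..n}" for p
    using hom_in_carrier[OF h, of p] that by (auto simp: sym_group_def units_of_def ring_mat_def Units_def)
  have i: "inv_into UNIV \<pi> permutes {1..n}" using \<pi> by (rule permutes_inv)
  have \<pi>\<sigma>: "\<pi> \<circ> \<sigma> permutes {1..n}" using \<sigma> \<pi> by (rule permutes_compose)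
  have "\<tau> = (\<pi> \<circ> \<sigma>) \<circ> inv_into UNIV \<pi>"
    using permutes_surj[OF \<pi>] by (simp flip: conj add: comp_assoc surj_iff)
  hence "mat_trace (\<rho> \<tau>) = mat_trace (\<rho> (\<pi> \<circ> \<sigma>) * \<rho> (inv_into UNIV \<pi>))" by (simp add: mult[OF \<pi>\<sigma> i])
  also have "\<dots> = mat_trace (\<rho> (inv_into UNIV \<pi>) * \<rho> (\<pi> \<circ> \<sigma>))"
    by (rule mat_trace_mult_commute[OF car[OF \<pi>\<sigma>] car[OF i]])
  also have "\<dots> = mat_trace (\<rho> (inv_into UNIV \<pi> \<circ> (\<pi> \<circ> \<sigma>)))" by (simp only: mult[OF i \<pi>\<sigma>])
  also have "inv_into UNIV \<pi> \<circ> (\<pi> \<circ> \<sigma>) = \<sigma>"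
    using permutes_inv_o(2)[OF \<pi>] by (simp flip: comp_assoc)
  finally show ?thesis .
qed

text \<open>The representative that \<^const>\<open>character_at_type\<close> chooses is conjugate to \<open>\<sigma>\<close>, and traces of
conjugate matrices agree.\<close>

lemma character_eq_character_at_type:
  assumes V: "is_virtual_rep n V" and \<sigma>: "\<sigma> permutes {1..n}" and ct: "cycle_type n \<sigma> = mset \<mu>"
  shows "character V \<sigma> = character_at_type n V \<mu>"
proof -
  define \<tau> where "\<tau> = (SOME \<sigma>. \<sigma> permutes {1..n} \<and> cycle_type n \<sigma> = mset \<mu>)"
  have \<tau>: "\<tau> permutes {1..n} \<and> cycle_type n \<tau> = mset \<mu>"
    unfolding \<tau>_def by (rule someI[of _ \<sigma>]) (use assms in simp)
  obtain \<pi> where "\<pi> permutes {1..n}" "\<tau> \<circ> \<pi> = \<pi> \<circ> \<sigma>"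
    using conjugate_if_orbit_cards_eq[of "{1..n}" \<sigma> \<tau>] \<tau> \<sigma> ct by (auto simp: cycle_type_def)
  hence "mat_trace (\<rho> \<tau>) = mat_trace (\<rho> \<sigma>)" if "is_rep n \<rho>" for \<rho>
    using mat_trace_rep_conjugate[OF that \<sigma>] by blast
  thus ?thesis
    using V unfolding character_at_type_def \<tau>_def[symmetric] by (simp add: character_def is_virtual_rep_def)
qed

section \<open>Eulerian polynomials\<close>

lemma EXC_permutes:
  assumes "\<sigma> permutes {1..m}"
  shows "EXC m \<sigma> = {i \<in> {1..m}. i < \<sigma> i}"
proof -
  have "\<sigma> m \<le> m"
    using permutes_in_image[OF assms, of m] permutes_not_in[OF assms, of m] by (cases "m \<in> {1..m}") auto
  thus ?thesis unfolding EXC_def by (auto simp: order.order_iff_strict)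
qed

lemma finite_EXC [simp]: "finite (EXC m \<sigma>)"
  by (simp add: EXC_def)

lemma EXC_Suc_fixed:
  assumes "p permutes {1..m}"
  shows "EXC (Suc m) p = EXC m p"
proof -
  have "p permutes {1..Suc m}" using assms by (rule permutes_subset) auto
  thus ?thesis
    using permutes_not_in[OF assms, of "Suc m"] assms by (auto simp: EXC_permutes le_Suc_eq)
qed

text \<open>The left hand permutation arises from \<open>p\<close> by inserting \<open>m + 1\<close> into a cycle between \<open>c\<close> and \<open>p c\<close>.
Hence \<open>c\<close> becomes an excedance and all other positions keep their status.\<close>

lemma EXC_transpose_Suc:
  assumes p: "p permutes {1..m}" and c: "c \<in> {1..m}"
  shows "EXC (Suc m) (transpose (Suc m) (p c) \<circ> p) = insert c (EXC m p)"
proof -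
  have b: "p c \<in> {1..m}" using permutes_in_image[OF p] c by blast
  have p': "p permutes {1..Suc m}" using p by (rule permutes_subset) auto
  have "transpose (Suc m) (p c) permutes {1..Suc m}"
    by (rule permutes_swap_id) (use b in auto)
  hence q: "(transpose (Suc m) (p c) \<circ> p) permutes {1..Suc m}"
    using p' by (rule permutes_compose[rotated])
  have v: "transpose (Suc m) (p c) (p i) = (if i = c then Suc m else if i = Suc m then p c else p i)"
    if "i \<in> {1..Suc m}" for i
  proof -
    have "p i = Suc m \<longleftrightarrow> i = Suc m"
      using permutes_in_image[OF p, of i] permutes_not_in[OF p, of i] that by auto
    moreover have "p i = p c \<longleftrightarrow> i = c" using permutes_inj[OF p] by (auto dest: injD)
    ultimately show ?thesis using permutes_not_in[OF p, of "Suc m"] c by (auto simp: transpose_def)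
  qed
  show ?thesis
    using v b c permutes_not_in[OF p, of "Suc m"] unfolding EXC_permutes[OF q] EXC_permutes[OF p]
    by (auto simp: split: if_splits)
qed

lemma X_times_pderiv_monom: "[:0, 1:] * pderiv (monom (1 :: int) k) = of_nat k * monom 1 k"
  by (cases k) (simp_all add: pderiv_monom flip: monom_Suc add: of_nat_poly smult_monom)

lemma eulerian_poly_0 [simp]: "eulerian_poly 0 = 1"
  by (simp add: eulerian_poly_def exc_def EXC_def monom_eq_1)

lemma pderiv_sum: "pderiv (\<Sum>x\<in>A. f x) = (\<Sum>x\<in>A. pderiv (f x))"
  by (induction A rule: infinite_finite_induct) (simp_all add: pderiv_add)

text \<open>Every permutation of \<open>[m+1]\<close> arises from a permutation \<open>p\<close> of \<open>[m]\<close> by adding \<open>m + 1\<close> as a fixed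
point or by inserting it behind some \<open>c\<close>.  If \<open>p\<close> has \<open>k\<close> excedances, then \<open>k + 1\<close> of these \<open>m + 1\<close>
choices keep the number of excedances and \<open>m - k\<close> raise it by one; the derivative produces the
factor \<open>k\<close>.\<close>

lemma eulerian_poly_Suc:
  "eulerian_poly (Suc m) = (1 + of_nat m * [:0, 1:]) * eulerian_poly m +
     [:0, 1:] * (1 - [:0, 1:]) * pderiv (eulerian_poly m)"
proof -
  let ?X = "[:0, 1 :: int:]"
  let ?P = "{p. p permutes {1..m}}"
  have Suc: "{1..Suc m} = insert (Suc m) {1..m}" by auto
  have fin: "finite ?P" by (rule finite_permutations) simp
  have "eulerian_poly (Suc m) =
     (\<Sum>b\<in>insert (Suc m) {1..m}. \<Sum>p\<in>?P. monom 1 (exc (Suc m) (transpose (Suc m) b \<circ> p)))"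
    unfolding eulerian_poly_def Suc by (rule sum_over_permutations_insert) auto
  also have "\<dots> = (\<Sum>p\<in>?P. monom 1 (exc (Suc m) p)) +
     (\<Sum>p\<in>?P. \<Sum>b=1..m. monom 1 (exc (Suc m) (transpose (Suc m) b \<circ> p)))"
    by (simp, rule sum.swap)
  also have "\<dots> = (\<Sum>p\<in>?P. monom 1 (exc (Suc m) p) +
     (\<Sum>b=1..m. monom 1 (exc (Suc m) (transpose (Suc m) b \<circ> p))))"
    by (simp add: sum.distrib)
  also have "\<dots> = (\<Sum>p\<in>?P. (1 + of_nat m * ?X) * monom 1 (exc m p) + ?X * (1 - ?X) * pderiv (monom 1 (exc m p)))"
  proof (rule sum.cong[OF refl])
    fix p assume "p \<in> ?P"
    hence p: "p permutes {1..m}" by simp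
    let ?k = "exc m p" and ?M = "monom (1::int) (exc m p)"
    have sub: "EXC m p \<subseteq> {1..m}" by (auto simp: EXC_permutes[OF p])
    have k: "?k \<le> m" using card_mono[OF _ sub] by (simp add: exc_def)
    have "(\<Sum>b=1..m. monom 1 (exc (Suc m) (transpose (Suc m) b \<circ> p))) =
          (\<Sum>c=1..m. monom 1 (exc (Suc m) (transpose (Suc m) (p c) \<circ> p)))"
      by (rule sum.reindex_bij_betw[symmetric]) (rule permutes_imp_bij[OF p])
    also have "\<dots> = (\<Sum>c=1..m. if c \<in> EXC m p then ?M else ?X * ?M)"
      by (intro sum.cong refl)
         (simp add: exc_def EXC_transpose_Suc[OF p] card_insert_if monom_Suc)
    also have "\<dots> = (\<Sum>c\<in>EXC m p. ?M) + (\<Sum>c\<in>{1..m} - EXC m p. ?X * ?M)"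
      by (subst sum.subset_diff[OF sub]) (simp_all add: add.commute)
    also have "\<dots> = of_nat ?k * ?M + of_nat (m - ?k) * (?X * ?M)"
      by (simp add: exc_def card_Diff_subset[OF _ sub] del: One_nat_def)
    also have "\<dots> = of_nat m * (?X * ?M) + (1 - ?X) * (of_nat ?k * ?M)"
      using k by (simp add: of_nat_diff algebra_simps)
    also have "\<dots> = of_nat m * ?X * ?M + (1 - ?X) * (?X * pderiv ?M)"
      unfolding X_times_pderiv_monom by (simp only: mult.assoc)
    finally show "monom 1 (exc (Suc m) p) +
       (\<Sum>b=1..m. monom 1 (exc (Suc m) (transpose (Suc m) b \<circ> p))) =
       (1 + of_nat m * ?X) * ?M + ?X * (1 - ?X) * pderiv ?M"
      by (simp only: exc_def EXC_Suc_fixed[OF p]) (simp only: algebra_simps)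
  qed
  also have "\<dots> = (1 + of_nat m * ?X) * eulerian_poly m + ?X * (1 - ?X) * pderiv (eulerian_poly m)"
    unfolding eulerian_poly_def pderiv_sum sum.distrib sum_distrib_left ..
  finally show ?thesis .
qed

definition power_fps :: "nat \<Rightarrow> int fps" where
  "power_fps k = Abs_fps (\<lambda>r. (int r + 1) ^ k)"

lemma power_fps_Suc: "power_fps (Suc k) = power_fps k + fps_X * fps_deriv (power_fps k)"
proof (rule fps_ext)
  fix r show "fps_nth (power_fps (Suc k)) r = fps_nth (power_fps k + fps_X * fps_deriv (power_fps k)) r"
    by (cases r) (simp_all add: power_fps_def algebra_simps)
qed

lemma fps_of_poly_of_nat: "fps_of_poly (of_nat n) = of_nat n"
  by (induction n) (simp_all add: fps_of_poly_add)

text \<open>Carlitz' identity \<open>A\<^sub>k(t) / (1 - t)^(k+1) = \<Sum>\<^sub>r (r + 1)^k t^r\<close>: multiplying the \<open>r\<close>-th coefficient by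
\<open>r + 1\<close> is the operator \<open>f \<mapsto> (t f)'\<close>, which on the left is the recurrence
\<open>eulerian_poly_Suc\<close>.\<close>

lemma fps_of_eulerian_poly:
  "fps_of_poly (eulerian_poly k) = (1 - fps_X) ^ Suc k * power_fps k"
proof (induction k)
  case 0
  have "(1 - fps_X) * power_fps 0 = 1"
  proof (rule fps_ext)
    fix n show "fps_nth ((1 - fps_X) * power_fps 0) n = fps_nth 1 n"
      by (cases n) (simp_all add: power_fps_def algebra_simps)
  qed
  thus ?case by simp
next
  case (Suc k)
  let ?C = "power_fps k" and ?U = "1 - fps_X :: int fps"
  have X: "fps_of_poly [:0, 1 :: int:] = fps_X" by (simp add: fps_of_poly_pCons)
  have dU: "fps_deriv (?U ^ Suc k) = - (of_nat (Suc k) * ?U ^ k)"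
    by (simp add: fps_deriv_power fps_of_nat del: of_nat_Suc power_Suc)
  have d: "fps_deriv (?U ^ Suc k * ?C) = ?U ^ k * (?U * fps_deriv ?C - of_nat (Suc k) * ?C)"
    unfolding fps_deriv_mult dU by (simp add: algebra_simps del: of_nat_Suc)
  have "fps_of_poly (eulerian_poly (Suc k)) =
        (1 + of_nat k * fps_X) * (?U ^ Suc k * ?C) + fps_X * ?U * fps_deriv (?U ^ Suc k * ?C)"
    unfolding eulerian_poly_Suc
    by (simp add: fps_of_poly_add fps_of_poly_mult fps_of_poly_diff X fps_of_poly_pderiv Suc.IH fps_of_poly_of_nat
         del: power_Suc mult_pCons_left mult_pCons_right)
  also have "\<dots> = ?U ^ Suc (Suc k) * (?C + fps_X * fps_deriv ?C)"
    unfolding d by (simp add: algebra_simps)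
  finally show ?case by (simp only: power_fps_Suc)
qed

lemma power_fps_binomial: "power_fps k - fps_X * (\<Sum>i\<le>k. of_nat (k choose i) * power_fps i) = 1"
proof (rule fps_ext)
  fix r
  have "(int s + 1 + 1) ^ k = (\<Sum>i\<le>k. of_nat (k choose i) * (int s + 1) ^ i)" for s
    by (subst binomial_ring) simp
  thus "fps_nth (power_fps k - fps_X * (\<Sum>i\<le>k. of_nat (k choose i) * power_fps i)) r = fps_nth 1 r"
    by (cases r) (simp_all add: power_fps_def fps_sum_nth flip: fps_of_nat add: algebra_simps)
qed

text \<open>The identity \<open>power_fps_binomial\<close>, which expands \<open>(r + 2)^k\<close> in powers of \<open>r + 1\<close>, multiplied by
\<open>(1 - t)^(k+1)\<close>.\<close>

lemma eulerian_poly_binomial: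
  "eulerian_poly k - [:0, 1:] * (\<Sum>i\<le>k. of_nat (k choose i) * (1 - [:0, 1:]) ^ (k - i) * eulerian_poly i) =
     (1 - [:0, 1:]) ^ Suc k"
proof -
  let ?U = "1 - fps_X :: int fps"
  have X: "fps_of_poly [:0, 1 :: int:] = fps_X" by (simp add: fps_of_poly_pCons)
  have "fps_of_poly (eulerian_poly k - [:0, 1:] * (\<Sum>i\<le>k. of_nat (k choose i) * (1 - [:0, 1:]) ^ (k - i) * eulerian_poly i))
     = ?U ^ Suc k * power_fps k -
       fps_X * (\<Sum>i\<le>k. of_nat (k choose i) * ?U ^ (k - i) * (?U ^ Suc i * power_fps i))"
    by (simp add: fps_of_poly_add fps_of_poly_mult fps_of_poly_diff fps_of_poly_sum fps_of_poly_power X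
         fps_of_eulerian_poly fps_of_poly_of_nat del: power_Suc mult_pCons_left mult_pCons_right)
  also have "(\<Sum>i\<le>k. of_nat (k choose i) * ?U ^ (k - i) * (?U ^ Suc i * power_fps i)) =
     (\<Sum>i\<le>k. ?U ^ Suc k * (of_nat (k choose i) * power_fps i))"
  proof (intro sum.cong refl)
    fix i assume "i \<in> {..k}"
    hence "?U ^ Suc k = ?U ^ (k - i) * ?U ^ Suc i" by (simp flip: power_add)
    thus "of_nat (k choose i) * ?U ^ (k - i) * (?U ^ Suc i * power_fps i) =
      ?U ^ Suc k * (of_nat (k choose i) * power_fps i)" by (simp only: mult_ac)
  qed
  also have "?U ^ Suc k * power_fps k - fps_X * \<dots> =
     ?U ^ Suc k * (power_fps k - fps_X * (\<Sum>i\<le>k. of_nat (k choose i) * power_fps i))"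
    by (simp only: sum_distrib_left[symmetric] right_diff_distrib mult.left_commute[of fps_X])
  also have "\<dots> = fps_of_poly ((1 - [:0, 1:]) ^ Suc k)"
    by (simp add: power_fps_binomial fps_of_poly_power fps_of_poly_diff fps_of_poly_mult X del: power_Suc)
  finally show ?thesis by (simp only: fps_of_poly_eq_iff)
qed

definition eulerian_egf :: "int \<Rightarrow> complex fps" where
  "eulerian_egf t = Abs_fps (\<lambda>k. of_int (poly (eulerian_poly k) t) / ((1 - of_int t) ^ k * fact k))"

text \<open>In other words, the series is \<open>(1 - t) e^y / (1 - t e^y)\<close>.  This form avoids the quotient; after
scaling by \<open>(1 - t)^k k!\<close>, its \<open>k\<close>-th coefficient is \<open>eulerian_poly_binomial\<close>.\<close>

lemma eulerian_egf_identity: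
  assumes "t \<noteq> 1"
  shows "eulerian_egf t * (1 - fps_const (of_int t) * fps_exp 1) = fps_const (1 - of_int t) * fps_exp 1"
proof (rule fps_ext)
  fix k
  define a where "a i = (of_int (poly (eulerian_poly i) t) :: complex)" for i
  define u where "u = (1 - of_int t :: complex)"
  have u: "u \<noteq> 0" using assms by (simp add: u_def)
  have "a k - of_int t * (\<Sum>i\<le>k. of_nat (k choose i) * u ^ (k - i) * a i) = u ^ Suc k"
    using arg_cong[OF eulerian_poly_binomial[of k], of "\<lambda>p. of_int (poly p t) :: complex"]
    by (simp add: a_def u_def poly_sum del: power_Suc)
  moreover have "(\<Sum>i\<le>k. of_nat (k choose i) * u ^ (k - i) * a i) =
      u ^ k * fact k * (\<Sum>i\<le>k. a i / (u ^ i * fact i) / fact (k - i))"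
    unfolding sum_distrib_left
  proof (intro sum.cong refl)
    fix i assume "i \<in> {..k}"
    hence i: "i \<le> k" by simp
    hence "u ^ k = u ^ (k - i) * u ^ i" by (simp flip: power_add)
    thus "of_nat (k choose i) * u ^ (k - i) * a i = u ^ k * fact k * (a i / (u ^ i * fact i) / fact (k - i))"
      using u by (simp add: binomial_fact[OF i])
  qed
  ultimately have "a k / (u ^ k * fact k) - of_int t * (\<Sum>i\<le>k. a i / (u ^ i * fact i) / fact (k - i)) = u / fact k"
    using u by (simp add: divide_simps) (simp add: algebra_simps)
  hence "fps_nth (eulerian_egf t - fps_const (of_int t) * (eulerian_egf t * fps_exp 1)) k = u / fact k"
    unfolding fps_sub_nth fps_mult_left_const_nth unfolding fps_mult_nth
    by (simp add: eulerian_egf_def a_def u_def atLeast0AtMost)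
  thus "fps_nth (eulerian_egf t * (1 - fps_const (of_int t) * fps_exp 1)) k =
        fps_nth (fps_const (1 - of_int t) * fps_exp 1) k"
    by (simp add: u_def algebra_simps)
qed

section \<open>Power sums\<close>

fun term_exponent :: "nat list \<Rightarrow> nat list \<Rightarrow> (nat \<Rightarrow>\<^sub>0 nat)" where
  "term_exponent (l # \<mu>) (i # b) = Poly_Mapping.single i l + term_exponent \<mu> b"
| "term_exponent _ _ = 0"

text \<open>Expanding \<open>p\<^sub>\<mu>\<close> means choosing a variable for every part of \<open>\<mu>\<close>.  Index \<open>0\<close> is excluded, because the
variables start with \<open>x\<^sub>1\<close>.\<close>

definition power_sum_terms :: "nat list \<Rightarrow> (nat \<Rightarrow>\<^sub>0 nat) \<Rightarrow> nat list set" where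
  "power_sum_terms \<mu> e = {b. length b = length \<mu> \<and> 0 \<notin> set b \<and> term_exponent \<mu> b = e}"

definition heavy_vars :: "(nat \<Rightarrow>\<^sub>0 nat) \<Rightarrow> nat \<Rightarrow> nat set" where
  "heavy_vars e l = {i. 1 \<le> i \<and> l \<le> Poly_Mapping.lookup e i}"

lemma finite_heavy_vars: "1 \<le> l \<Longrightarrow> finite (heavy_vars e l)"
  by (rule finite_subset[of _ "Poly_Mapping.keys e"]) (auto simp: heavy_vars_def in_keys_iff)

lemma single_add_diff:
  assumes "l \<le> Poly_Mapping.lookup e i"
  shows "Poly_Mapping.single i l + (e - Poly_Mapping.single i l) = (e :: nat \<Rightarrow>\<^sub>0 nat)"
  using assms by (intro poly_mapping_eqI) (auto simp: lookup_add lookup_minus lookup_single when_def)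

lemma power_sum_terms_Cons:
  "power_sum_terms (l # \<mu>) e =
     (\<lambda>(i, b). i # b) ` (SIGMA i:heavy_vars e l. power_sum_terms \<mu> (e - Poly_Mapping.single i l))"
proof (intro equalityI subsetI)
  fix b assume b: "b \<in> power_sum_terms (l # \<mu>) e"
  then obtain i b' where ib: "b = i # b'" "length b' = length \<mu>" "0 \<notin> set b'" "1 \<le> i"
      "Poly_Mapping.single i l + term_exponent \<mu> b' = e"
    by (cases b) (auto simp: power_sum_terms_def Suc_le_eq)
  have "l \<le> Poly_Mapping.lookup e i" unfolding ib(5)[symmetric] by (simp add: lookup_add)
  moreover have "term_exponent \<mu> b' = e - Poly_Mapping.single i l"
    unfolding ib(5)[symmetric] by simp
  ultimately show "b \<in> (\<lambda>(i, b). i # b) ` (SIGMA i:heavy_vars e l. power_sum_terms \<mu> (e - Poly_Mapping.single i l))"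
    using ib by (auto simp: heavy_vars_def power_sum_terms_def)
next
  fix b assume "b \<in> (\<lambda>(i, b). i # b) ` (SIGMA i:heavy_vars e l. power_sum_terms \<mu> (e - Poly_Mapping.single i l))"
  thus "b \<in> power_sum_terms (l # \<mu>) e"
    using single_add_diff by (auto simp: heavy_vars_def power_sum_terms_def)
qed

lemma power_sum_partition_Cons:
  assumes "1 \<le> l"
  shows "power_sum_partition (l # \<mu>) e =
     (\<Sum>i\<in>heavy_vars e l. power_sum_partition \<mu> (e - Poly_Mapping.single i l))"
proof -
  let ?I = "\<lambda>a. {i. i \<ge> 1 \<and> Poly_Mapping.single i l = a}"
  have "power_sum_partition (l # \<mu>) e =
     (\<Sum>(a, c) | a + c = e. \<Sum>i\<in>?I a. power_sum_partition \<mu> c)"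
    by (simp add: power_sum_partition_def series_mult_def power_sum_def case_prod_unfold)
  also have "\<dots> = (\<Sum>p\<in>{(a, c). a + c = e}. \<Sum>i\<in>?I (fst p). power_sum_partition \<mu> (snd p))"
    by (simp add: case_prod_unfold)
  also have "\<dots> = (\<Sum>(p, i)\<in>(SIGMA p:{(a, c). a + c = e}. ?I (fst p)). power_sum_partition \<mu> (snd p))"
    by (rule sum.Sigma)
       (use finite_power_sum_index[OF assms] finite_series_mult_index in \<open>auto simp del: One_nat_def\<close>)
  also have "\<dots> = (\<Sum>i\<in>heavy_vars e l. power_sum_partition \<mu> (e - Poly_Mapping.single i l))"
    by (rule sum.reindex_bij_witness[of _
          "\<lambda>i. ((Poly_Mapping.single i l, e - Poly_Mapping.single i l), i)" snd])
       (auto simp: heavy_vars_def single_add_diff lookup_add)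
  finally show ?thesis .
qed

lemma power_sum_terms_card:
  assumes "\<forall>l\<in>set \<mu>. 1 \<le> l"
  shows "finite (power_sum_terms \<mu> e) \<and>
         power_sum_partition \<mu> e = of_nat (card (power_sum_terms \<mu> e))"
  using assms
proof (induction \<mu> arbitrary: e)
  case Nil
  have "power_sum_terms [] e = (if e = 0 then {[]} else {})" by (auto simp: power_sum_terms_def)
  thus ?case by (simp add: power_sum_partition_def series_one_def)
next
  case (Cons l \<mu>)
  have l: "1 \<le> l" using Cons.prems by simp
  have inj: "inj_on (\<lambda>(i, b). i # b) A" for A :: "(nat \<times> nat list) set" by (auto simp: inj_on_def)
  have IH: "finite (power_sum_terms \<mu> e)"
      "power_sum_partition \<mu> e = of_nat (card (power_sum_terms \<mu> e))" for e
    using Cons by auto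
  show ?case
    unfolding power_sum_terms_Cons card_image[OF inj] power_sum_partition_Cons[OF l] IH(2)
    using finite_heavy_vars[OF l] IH(1) by (auto simp: card_SigmaI)
qed

text \<open>Expanding two factors at once makes the symmetry visible: both sides are sums over the pairs of
variables that can be split off from \<open>e\<close>.\<close>

lemma power_sum_partition_swap:
  assumes "1 \<le> l" "1 \<le> k"
  shows "power_sum_partition (l # k # \<mu>) = power_sum_partition (k # l # \<mu>)"
proof
  fix e :: "nat \<Rightarrow>\<^sub>0 nat"
  define P where "P = {(i, j). 1 \<le> i \<and> 1 \<le> j \<and> l \<le> Poly_Mapping.lookup e i \<and> k \<le> Poly_Mapping.lookup (e - Poly_Mapping.single i l) j}"
  define P' where "P' = {(j, i). 1 \<le> i \<and> 1 \<le> j \<and> k \<le> Poly_Mapping.lookup e j \<and> l \<le> Poly_Mapping.lookup (e - Poly_Mapping.single j k) i}"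
  let ?s = Poly_Mapping.single
  have "power_sum_partition (l # k # \<mu>) e = (\<Sum>(i, j)\<in>P. power_sum_partition \<mu> (e - ?s i l - ?s j k))"
    unfolding power_sum_partition_Cons[OF assms(1)] power_sum_partition_Cons[OF assms(2)] P_def
    by (subst sum.Sigma)
       (use finite_heavy_vars[OF assms(1)] finite_heavy_vars[OF assms(2)]
        in \<open>auto intro!: sum.cong simp: heavy_vars_def\<close>)
  also have "\<dots> = (\<Sum>(j, i)\<in>P'. power_sum_partition \<mu> (e - ?s j k - ?s i l))"
    by (rule sum.reindex_bij_witness[of _ "\<lambda>(j, i). (i, j)" "\<lambda>(j, i). (i, j)"])
       (auto simp: P_def P'_def lookup_minus lookup_single when_def diff_diff_eq add.commute split: if_splits)
  also have "\<dots> = power_sum_partition (k # l # \<mu>) e"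
    unfolding power_sum_partition_Cons[OF assms(1)] power_sum_partition_Cons[OF assms(2)] P'_def
    by (subst sum.Sigma)
       (use finite_heavy_vars[OF assms(1)] finite_heavy_vars[OF assms(2)]
        in \<open>auto intro!: sum.cong simp: heavy_vars_def\<close>)
  finally show "power_sum_partition (l # k # \<mu>) e = power_sum_partition (k # l # \<mu>) e" .
qed

lemma power_sum_partition_Cons_cong:
  "power_sum_partition \<mu> = power_sum_partition \<nu> \<Longrightarrow>
   power_sum_partition (l # \<mu>) = power_sum_partition (l # \<nu>)"
  by (simp add: power_sum_partition_def)

lemma power_sum_partition_remove1:
  assumes "\<forall>l\<in>set \<mu>. 1 \<le> l" "a \<in> set \<mu>"
  shows "power_sum_partition (a # remove1 a \<mu>) = power_sum_partition \<mu>"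
  using assms
proof (induction \<mu>)
  case (Cons l \<mu>)
  show ?case
  proof (cases "a = l")
    case False
    have "power_sum_partition (a # l # remove1 a \<mu>) = power_sum_partition (l # a # remove1 a \<mu>)"
      using Cons.prems by (intro power_sum_partition_swap) auto
    also have "\<dots> = power_sum_partition (l # \<mu>)"
      using Cons False by (intro power_sum_partition_Cons_cong) auto
    finally show ?thesis using False by auto
  qed simp
qed simp

lemma power_sum_partition_mset_cong:
  assumes "\<forall>l\<in>set \<mu>. 1 \<le> l" "mset \<mu> = mset \<nu>"
  shows "power_sum_partition \<mu> = power_sum_partition \<nu>"
  using assms
proof (induction \<mu> arbitrary: \<nu>)
  case (Cons l \<mu>)
  have l: "l \<in> set \<nu>" and "set \<nu> = set (l # \<mu>)"
    using Cons.prems(2) by (metis list.set_intros(1) set_mset_mset, metis set_mset_mset)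
  hence pos: "\<forall>l\<in>set \<nu>. 1 \<le> l" using Cons.prems(1) by simp
  have "mset \<mu> = mset (remove1 l \<nu>)" using Cons.prems(2) l by (simp flip: Cons.prems(2))
  hence "power_sum_partition \<mu> = power_sum_partition (remove1 l \<nu>)"
    using Cons by simp
  hence "power_sum_partition (l # \<mu>) = power_sum_partition (l # remove1 l \<nu>)"
    by (rule power_sum_partition_Cons_cong)
  thus ?case using power_sum_partition_remove1[OF pos l] by simp
qed simp

text \<open>This is the operator \<open>\<partial>/\<partial>p\<^sub>1\<close>.  If the variable \<open>x\<^sub>M\<close> occurs to the first power only, then it comes
from exactly one of the factors, and that factor must be a \<open>p\<^sub>1\<close>.\<close>

lemma power_sum_partition_new_variable:
  assumes "\<forall>l\<in>set \<mu>. 1 \<le> l" "M \<notin> Poly_Mapping.keys e" "1 \<le> M"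
  shows "power_sum_partition \<mu> (e + Poly_Mapping.single M 1) =
         of_nat (count_list \<mu> 1) * power_sum_partition (remove1 1 \<mu>) e"
  using assms
proof (induction \<mu> arbitrary: e)
  case Nil
  have "Poly_Mapping.lookup (e + Poly_Mapping.single M 1) M \<noteq> 0" by (simp add: lookup_add)
  hence "e + Poly_Mapping.single M 1 \<noteq> 0" by (metis lookup_zero)
  thus ?case by (simp add: power_sum_partition_def series_one_def)
next
  case (Cons l \<mu>)
  let ?s = "Poly_Mapping.single :: nat \<Rightarrow> nat \<Rightarrow> _"
  have l: "1 \<le> l" and pos: "\<forall>l\<in>set \<mu>. 1 \<le> l" using Cons.prems by auto
  have eM: "Poly_Mapping.lookup e M = 0" using Cons.prems by (simp add: in_keys_iff)
  have V: "heavy_vars (e + ?s M 1) l = (if l = 1 then {M} else {}) \<union> heavy_vars e l"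
    using l eM Cons.prems(3) by (auto simp: heavy_vars_def lookup_add lookup_single when_def split: if_splits)
  have "(\<Sum>i\<in>heavy_vars e l. power_sum_partition \<mu> (e + ?s M 1 - ?s i l)) =
        (\<Sum>i\<in>heavy_vars e l. of_nat (count_list \<mu> 1) * power_sum_partition (remove1 1 \<mu>) (e - ?s i l))"
  proof (intro sum.cong refl)
    fix i assume i: "i \<in> heavy_vars e l"
    have "e + ?s M 1 - ?s i l = (e - ?s i l) + ?s M 1"
      using i eM l by (intro poly_mapping_eqI)
        (auto simp: heavy_vars_def lookup_add lookup_minus lookup_single when_def)
    moreover have "M \<notin> Poly_Mapping.keys (e - ?s i l)" using eM by (simp add: in_keys_iff lookup_minus)
    ultimately show "power_sum_partition \<mu> (e + ?s M 1 - ?s i l) =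
      of_nat (count_list \<mu> 1) * power_sum_partition (remove1 1 \<mu>) (e - ?s i l)"
      using Cons.IH[OF pos _ Cons.prems(3)] by simp
  qed
  also have "\<dots> = of_nat (count_list \<mu> 1) * power_sum_partition (l # remove1 1 \<mu>) e"
    by (simp add: power_sum_partition_Cons[OF l] sum_distrib_left)
  finally have *: "(\<Sum>i\<in>heavy_vars e l. power_sum_partition \<mu> (e + ?s M 1 - ?s i l)) =
     of_nat (count_list \<mu> 1) * power_sum_partition (l # remove1 1 \<mu>) e" .
  show ?case
  proof (cases "l = 1")
    case True
    have "M \<notin> heavy_vars e l" using eM l by (simp add: heavy_vars_def)
    hence "power_sum_partition (l # \<mu>) (e + ?s M 1) =
        power_sum_partition \<mu> e + of_nat (count_list \<mu> 1) * power_sum_partition (1 # remove1 1 \<mu>) e"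
      using True finite_heavy_vars[OF l] *
      unfolding power_sum_partition_Cons[OF l, of \<mu>] V by (simp del: One_nat_def)
    also have "of_nat (count_list \<mu> 1) * power_sum_partition (1 # remove1 1 \<mu>) e =
               of_nat (count_list \<mu> 1) * power_sum_partition \<mu> e"
      using power_sum_partition_remove1[OF pos, of 1] by (cases "1 \<in> set \<mu>") (simp_all add: count_list_0_iff del: One_nat_def)
    finally show ?thesis using True by (simp add: algebra_simps del: One_nat_def)
  next
    case False
    thus ?thesis using * unfolding power_sum_partition_Cons[OF l, of \<mu>] V by (simp del: One_nat_def)
  qed
qed

lemma lookup_term_exponent_notin: "i \<notin> set b \<Longrightarrow> Poly_Mapping.lookup (term_exponent \<mu> b) i = 0"
  by (induction \<mu> b rule: term_exponent.induct) (auto simp: lookup_add lookup_single when_def)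

lemma map_lookup_term_exponent:
  assumes "length b = length \<mu>" "distinct b"
  shows "map (Poly_Mapping.lookup (term_exponent \<mu> b)) b = \<mu>"
  using assms
proof (induction b \<mu> rule: list_induct2)
  case (Cons i b l \<mu>)
  let ?e = "term_exponent \<mu> b"
  have "map (Poly_Mapping.lookup (Poly_Mapping.single i l + ?e)) b = map (Poly_Mapping.lookup ?e) b"
    using Cons.prems by (intro map_cong refl) (auto simp: lookup_add lookup_single when_def)
  also have "\<dots> = \<mu>" using Cons by simp
  finally have "map (Poly_Mapping.lookup (Poly_Mapping.single i l + ?e)) b = \<mu>" .
  moreover have "Poly_Mapping.lookup (Poly_Mapping.single i l + ?e) i = l"
    using Cons.prems by (simp add: lookup_add lookup_term_exponent_notin)
  ultimately show ?case by simp
qed simp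

lemma partition_eq_if_mset_eq:
  assumes "is_partition n \<mu>" "is_partition n \<nu>" "mset \<mu> = mset \<nu>"
  shows "\<mu> = \<nu>"
proof -
  have "sorted (rev \<mu>)" "sorted (rev \<nu>)"
    using assms(1,2) by (auto simp: is_partition_def sorted_wrt_rev)
  hence "rev \<mu> = rev \<nu>" using assms(3) by (metis mset_rev properties_for_sort)
  thus ?thesis by simp
qed

text \<open>The power sums are triangular with respect to the number of parts.  Let \<open>\<nu>\<close> be a longest partition
with nonzero coefficient and consider the monomial with exponents \<open>\<nu>\<close>.  It occurs in \<open>p\<^sub>\<kappa>\<close> only if
merging parts of \<open>\<kappa>\<close> gives \<open>\<nu>\<close>, so \<open>\<kappa>\<close> has at least as many parts as \<open>\<nu>\<close>, and then \<open>\<kappa> = \<nu>\<close> by the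
choice of \<open>\<nu>\<close>.\<close>

lemma power_sums_linearly_independent:
  assumes zero: "\<And>e. 0 \<notin> Poly_Mapping.keys e \<Longrightarrow> (\<Sum>\<nu> | is_partition m \<nu>. d \<nu> * power_sum_partition \<nu> e) = 0"
    and \<nu>0: "is_partition m \<nu>\<^sub>0"
  shows "d \<nu>\<^sub>0 = 0"
proof (rule ccontr)
  assume "d \<nu>\<^sub>0 \<noteq> 0"
  define D where "D = {\<nu>. is_partition m \<nu> \<and> d \<nu> \<noteq> 0}"
  have fin: "finite D" unfolding D_def by (rule finite_subset[OF _ finite_partitions[of m]]) auto
  have "D \<noteq> {}" using \<nu>0 \<open>d \<nu>\<^sub>0 \<noteq> 0\<close> by (auto simp: D_def)
  hence "Max (length ` D) \<in> length ` D" using fin by (intro Max_in) auto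
  then obtain \<nu> where "\<nu> \<in> D" "length \<nu> = Max (length ` D)" by (metis imageE)
  hence \<nu>: "\<nu> \<in> D" "\<And>\<kappa>. \<kappa> \<in> D \<Longrightarrow> length \<kappa> \<le> length \<nu>"
    using fin by simp_all
  have p\<nu>: "is_partition m \<nu>" and pos: "\<forall>l\<in>set \<nu>. 1 \<le> l"
    using \<nu> by (auto simp: D_def is_partition_def)
  let ?L = "[1..<Suc (length \<nu>)]"
  define e where "e = term_exponent \<nu> ?L"
  have \<nu>_eq: "map (Poly_Mapping.lookup e) ?L = \<nu>" unfolding e_def by (rule map_lookup_term_exponent) (simp_all del: upt_Suc)
  have e0: "0 \<notin> Poly_Mapping.keys e" by (simp add: e_def in_keys_iff lookup_term_exponent_notin del: upt_Suc)
  have L: "set ?L \<subseteq> Poly_Mapping.keys e"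
  proof
    fix i assume "i \<in> set ?L"
    hence "Poly_Mapping.lookup e i \<in> set \<nu>" by (subst \<nu>_eq[symmetric]) (simp del: upt_Suc)
    thus "i \<in> Poly_Mapping.keys e" using pos by (force simp: in_keys_iff)
  qed
  have other: "d \<kappa> * power_sum_partition \<kappa> e = 0" if \<kappa>: "is_partition m \<kappa>" "\<kappa> \<noteq> \<nu>" for \<kappa>
  proof (cases "d \<kappa> = 0")
    case False
    hence len: "length \<kappa> \<le> length \<nu>" using \<kappa> \<nu>(2) by (auto simp: D_def)
    have "power_sum_terms \<kappa> e = {}"
    proof (rule ccontr)
      assume "power_sum_terms \<kappa> e \<noteq> {}"
      then obtain b where b: "length b = length \<kappa>" "term_exponent \<kappa> b = e"
        by (auto simp: power_sum_terms_def)
      have sub: "set ?L \<subseteq> set b"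
        using L lookup_term_exponent_notin[of _ b \<kappa>] by (auto simp: b(2) in_keys_iff)
      have "card (set ?L) = length \<nu>" by (simp del: upt_Suc)
      hence c: "card (set b) = length b" "set b = set ?L"
        using card_mono[OF _ sub] card_length[of b] len b(1) card_subset_eq[OF _ sub] by auto
      hence dist: "distinct b" by (simp add: card_distinct)
      have "mset b = mset ?L" using dist c(2) set_eq_iff_mset_eq_distinct[of b ?L] by (simp del: upt_Suc set_upt)
      moreover have "map (Poly_Mapping.lookup e) b = \<kappa>" using map_lookup_term_exponent[OF b(1) dist] b(2) by simp
      ultimately have "mset \<kappa> = mset \<nu>" using \<nu>_eq by (metis mset_map)
      thus False using partition_eq_if_mset_eq[OF \<kappa>(1) p\<nu>] \<kappa>(2) by simp
    qed
    thus ?thesis using power_sum_terms_card[of \<kappa> e] \<kappa> by (simp add: is_partition_def)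
  qed simp
  have "?L \<in> power_sum_terms \<nu> e" by (simp add: power_sum_terms_def e_def del: upt_Suc)
  hence "power_sum_partition \<nu> e \<noteq> 0" using power_sum_terms_card[OF pos, of e] by auto
  moreover have "(\<Sum>\<kappa> | is_partition m \<kappa>. d \<kappa> * power_sum_partition \<kappa> e) = d \<nu> * power_sum_partition \<nu> e"
  proof -
    have "(\<Sum>\<kappa>\<in>{\<kappa>. is_partition m \<kappa>} - {\<nu>}. d \<kappa> * power_sum_partition \<kappa> e) = 0"
      by (rule sum.neutral) (use other in blast)
    thus ?thesis using sum.remove[OF finite_partitions[of m], of \<nu> "\<lambda>\<kappa>. d \<kappa> * power_sum_partition \<kappa> e"] p\<nu> by simp
  qed
  ultimately show False using zero[OF e0] \<nu>(1) by (auto simp: D_def)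
qed

lemma is_partition_snoc_1: "is_partition (Suc m) (\<nu> @ [1]) \<longleftrightarrow> is_partition m \<nu>"
  by (auto simp: is_partition_def sorted_wrt_append)

lemma is_partition_with_1:
  assumes "is_partition (Suc m) \<mu>" "1 \<in> set \<mu>"
  obtains \<nu> where "\<mu> = \<nu> @ [1]" "is_partition m \<nu>"
proof -
  have ne: "\<mu> \<noteq> []" using assms(2) by auto
  have s: "sorted_wrt (\<ge>) (butlast \<mu> @ [last \<mu>])" and pos: "\<forall>i\<in>set \<mu>. 1 \<le> i"
    using assms(1) ne by (auto simp: is_partition_def)
  have mem: "1 \<in> set (butlast \<mu> @ [last \<mu>])" using assms(2) ne by simp
  have "last \<mu> \<le> 1"
    using s mem by (auto simp: sorted_wrt_append)
  moreover have "last \<mu> \<ge> 1" using pos ne by simp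
  ultimately have "\<mu> = butlast \<mu> @ [1]" using ne by (metis append_butlast_last_id le_antisym)
  thus ?thesis using that assms(1) is_partition_snoc_1 by metis
qed

lemma z_partition_snoc_1: "z_partition (\<nu> @ [1]) = (count_list \<nu> 1 + 1) * z_partition \<nu>"
proof -
  let ?f = "\<lambda>\<mu> i. i ^ count_list \<mu> i * fact (count_list \<mu> i) :: nat"
  have "z_partition \<nu> = (\<Prod>i\<in>insert 1 (set \<nu>). ?f \<nu> i)"
    unfolding z_partition_def by (rule prod.mono_neutral_left) auto
  also have "\<dots> = fact (count_list \<nu> 1) * (\<Prod>i\<in>set \<nu> - {1}. ?f \<nu> i)"
    by (subst prod.insert_remove) auto
  finally have z: "z_partition \<nu> = fact (count_list \<nu> 1) * (\<Prod>i\<in>set \<nu> - {1}. ?f \<nu> i)" .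
  have "z_partition (\<nu> @ [1]) = fact (Suc (count_list \<nu> 1)) * (\<Prod>i\<in>set \<nu> - {1}. ?f (\<nu> @ [1]) i)"
    unfolding z_partition_def by (simp, subst prod.insert_remove) auto
  also have "(\<Prod>i\<in>set \<nu> - {1}. ?f (\<nu> @ [1]) i) = (\<Prod>i\<in>set \<nu> - {1}. ?f \<nu> i)"
    by (intro prod.cong) auto
  finally show ?thesis unfolding z by (simp add: algebra_simps del: One_nat_def)
qed

section \<open>The generating function of weighted words\<close>

definition step_poly :: "nat \<Rightarrow> nat \<Rightarrow> int poly" where
  "step_poly a b = (if a \<le> b then 1 else 0) + (if b \<le> a then monom 1 1 else 0)"

fun word_poly :: "nat list \<Rightarrow> int poly" where
  "word_poly [] = 1"
| "word_poly [a] = 1"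
| "word_poly (a # b # w) = step_poly a b * word_poly (b # w)"

definition words :: "nat \<Rightarrow> nat \<Rightarrow> nat list set" where
  "words N m = {w. set w \<subseteq> {1..N} \<and> length w = m}"

lemma finite_words [simp]: "finite (words N m)"
  unfolding words_def by (rule finite_lists_length_eq) simp

lemma words_0 [simp]: "words N 0 = {[]}"
  by (auto simp: words_def)

lemma sum_words_Suc: "(\<Sum>w\<in>words N (Suc m). f w) = (\<Sum>b=1..N. \<Sum>w\<in>words N m. f (b # w))"
proof -
  have "(\<Sum>w\<in>words N (Suc m). f w) = (\<Sum>(b, w)\<in>{1..N} \<times> words N m. f (b # w))"
    by (rule sum.reindex_bij_witness[of _ "\<lambda>(b, w). b # w" "\<lambda>w. (hd w, tl w)"])
       (auto simp: words_def length_Suc_conv)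
  thus ?thesis by (simp add: sum.cartesian_product)
qed

definition word_weight :: "(nat \<Rightarrow> complex) \<Rightarrow> int \<Rightarrow> nat list \<Rightarrow> complex" where
  "word_weight x t w = prod_list (map x w) * of_int (poly (word_poly w) t)"

definition word_series :: "(nat \<Rightarrow> complex) \<Rightarrow> int \<Rightarrow> nat \<Rightarrow> complex fps" where
  "word_series x t N = Abs_fps (\<lambda>m. if m = 0 then 0 else \<Sum>w\<in>words N m. word_weight x t w)"

definition head_series :: "(nat \<Rightarrow> complex) \<Rightarrow> int \<Rightarrow> nat \<Rightarrow> nat \<Rightarrow> complex fps" where
  "head_series x t N b =
     Abs_fps (\<lambda>m. if m = 0 then 0 else \<Sum>w\<in>words N (m - 1). word_weight x t (b # w))"

lemma word_series_eq_sum_head_series: "word_series x t N = (\<Sum>b=1..N. head_series x t N b)"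
proof (rule fps_ext)
  fix m show "fps_nth (word_series x t N) m = fps_nth (\<Sum>b=1..N. head_series x t N b) m"
    by (cases m) (simp_all add: word_series_def head_series_def fps_sum_nth sum_words_Suc)
qed

lemma head_series_step:
  "head_series x t N b = fps_X * fps_const (x b) *
     (1 + (\<Sum>c=1..N. fps_const (of_int (poly (step_poly b c) t)) * head_series x t N c))"
proof (rule fps_ext)
  fix m
  consider "m = 0" | "m = 1" | k where "m = Suc (Suc k)"
    by (metis One_nat_def old.nat.exhaust)
  then show "fps_nth (head_series x t N b) m = fps_nth (fps_X * fps_const (x b) *
     (1 + (\<Sum>c=1..N. fps_const (of_int (poly (step_poly b c) t)) * head_series x t N c))) m"
  proof cases
    case 3
    have "(\<Sum>w\<in>words N k. word_weight x t (b # c # w)) =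
          x b * (of_int (poly (step_poly b c) t) * (\<Sum>w\<in>words N k. word_weight x t (c # w)))" for c
      by (simp add: word_weight_def sum_distrib_left mult_ac)
    with 3 show ?thesis
      by (simp add: mult.assoc head_series_def sum_words_Suc fps_sum_nth sum_distrib_left)
  qed (simp_all add: mult.assoc head_series_def word_weight_def fps_sum_nth)
qed

lemma poly_step_poly:
  "of_int (poly (step_poly b c) t) =
     (1 + (if c = b then of_int t else 0) + (if c < b then of_int t - 1 else 0) :: complex)"
  by (simp add: step_poly_def poly_monom)

text \<open>With \<open>c\<close> the second letter, the weight of the first step is \<open>1\<close>, plus \<open>t\<close> if \<open>c = b\<close>, plus \<open>t - 1\<close> if
\<open>c < b\<close>.  The constant \<open>1\<close> contributes the whole series and the rest involves only letters up to
\<open>b\<close>, so the equations can be solved for one letter after the other.\<close>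

lemma head_series_solved:
  assumes "b \<in> {1..N}"
  shows "(1 - fps_const (of_int t * x b) * fps_X) * head_series x t N b = fps_X * fps_const (x b) *
     (1 + word_series x t N + fps_const (of_int t - 1) * (\<Sum>c=1..<b. head_series x t N c))"
proof -
  let ?v = "head_series x t N"
  have "(\<Sum>c=1..N. fps_const (of_int (poly (step_poly b c) t)) * ?v c) =
     (\<Sum>c=1..N. ?v c) + (\<Sum>c=1..N. if c = b then fps_const (of_int t) * ?v c else 0) +
     (\<Sum>c=1..N. if c < b then fps_const (of_int t - 1) * ?v c else 0)"
    unfolding sum.distrib[symmetric]
    by (intro sum.cong refl) (auto simp: poly_step_poly algebra_simps simp flip: fps_const_add)
  also have "(\<Sum>c=1..N. if c = b then fps_const (of_int t) * ?v c else 0) = fps_const (of_int t) * ?v b"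
    using assms by simp
  also have "(\<Sum>c=1..N. if c < b then fps_const (of_int t - 1) * ?v c else 0) =
      fps_const (of_int t - 1) * (\<Sum>c=1..<b. ?v c)"
    unfolding sum_distrib_left using assms by (intro sum.mono_neutral_cong_right) auto
  finally have "(\<Sum>c=1..N. fps_const (of_int (poly (step_poly b c) t)) * ?v c) =
     word_series x t N + fps_const (of_int t) * ?v b + fps_const (of_int t - 1) * (\<Sum>c=1..<b. ?v c)"
    by (simp only: word_series_eq_sum_head_series)
  hence eq: "?v b = fps_X * fps_const (x b) *
     (1 + (word_series x t N + fps_const (of_int t) * ?v b + fps_const (of_int t - 1) * (\<Sum>c=1..<b. ?v c)))"
    by (intro trans[OF head_series_step]) (simp only:)
  define a where "a = fps_X * fps_const (x b)"
  define W where "W = word_series x t N"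
  define R where "R = fps_const (of_int t - 1) * (\<Sum>c=1..<b. ?v c)"
  let ?t = "fps_const (of_int t :: complex)"
  have "fps_const (of_int t * x b) * fps_X = a * ?t"
    by (simp add: a_def mult_ac flip: fps_const_mult)
  hence "(1 - fps_const (of_int t * x b) * fps_X) * ?v b = ?v b - a * (?t * ?v b)"
    by (simp only: left_diff_distrib mult_1_left mult.assoc)
  also have "\<dots> = a * (1 + (W + ?t * ?v b + R)) - a * (?t * ?v b)"
    using eq unfolding a_def W_def R_def by (rule arg_cong[where f = "\<lambda>z. z - fps_X * fps_const (x b) * (?t * ?v b)"])
  also have "\<dots> = a * (1 + W + R)"
    by (simp only: distrib_left) simp
  finally show ?thesis unfolding a_def W_def R_def .
qed

definition lin_prod :: "(nat \<Rightarrow> complex) \<Rightarrow> complex \<Rightarrow> nat \<Rightarrow> complex fps" where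
  "lin_prod x c N = (\<Prod>b=1..N. 1 - fps_const (c * x b) * fps_X)"

text \<open>By \<open>head_series_solved\<close>, admitting one more first letter \<open>b\<close> multiplies
\<open>1 + V + (t - 1) s\<^sub>b\<close> by \<open>(1 - x\<^sub>b z) / (1 - t x\<^sub>b z)\<close>, where \<open>V\<close> is the series of all words and \<open>s\<^sub>b\<close> that of
the words with first letter at most \<open>b\<close>.\<close>

lemma partial_sum_head_series:
  assumes "b \<le> N"
  shows "lin_prod x (of_int t) b *
      (1 + word_series x t N + fps_const (of_int t - 1) * (\<Sum>c=1..b. head_series x t N c)) =
    lin_prod x 1 b * (1 + word_series x t N)"
  using assms
proof (induction b)
  case (Suc b)
  let ?v = "head_series x t N" and ?W = "1 + word_series x t N"
  let ?T = "fps_const (of_int t - 1 :: complex)"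
  define s where "s = (\<Sum>c=1..b. ?v c)"
  let ?z = "fps_X * fps_const (x (Suc b))"
  have s: "(\<Sum>c=1..<Suc b. ?v c) = s" by (simp add: s_def atLeastLessThanSuc_atLeastAtMost)
  have l: "lin_prod x c (Suc b) = lin_prod x c b * (1 - fps_const (c * x (Suc b)) * fps_X)" for c
    by (simp add: lin_prod_def)
  have c: "fps_const (of_int t * x (Suc b)) * fps_X = (1 + ?T) * ?z"
    by (simp add: algebra_simps flip: fps_const_mult fps_const_sub)
  have h: "(1 - (1 + ?T) * ?z) * ?v (Suc b) = ?z * (?W + ?T * s)"
    using head_series_solved[of "Suc b" N t x] Suc.prems unfolding s c by simp
  have "(1 - (1 + ?T) * ?z) * (?W + ?T * (s + ?v (Suc b))) =
        (1 - (1 + ?T) * ?z) * (?W + ?T * s) + ?T * ((1 - (1 + ?T) * ?z) * ?v (Suc b))"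
    by (simp add: algebra_simps)
  also have "\<dots> = (1 - ?z) * (?W + ?T * s)"
    unfolding h by (simp add: algebra_simps)
  finally have e: "(1 - (1 + ?T) * ?z) * (?W + ?T * (s + ?v (Suc b))) = (1 - ?z) * (?W + ?T * s)" .
  have "lin_prod x (of_int t) (Suc b) * (?W + ?T * (\<Sum>c=1..Suc b. ?v c)) =
     lin_prod x (of_int t) b * ((1 - (1 + ?T) * ?z) * (?W + ?T * (s + ?v (Suc b))))"
    unfolding l c by (simp add: s_def mult.assoc)
  also have "\<dots> = (1 - ?z) * (lin_prod x (of_int t) b * (?W + ?T * s))"
    unfolding e by (simp add: mult_ac)
  also have "\<dots> = lin_prod x 1 (Suc b) * ?W"
    using Suc unfolding s_def l by (simp add: mult_ac)
  finally show ?case .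
qed (simp add: lin_prod_def)

text \<open>All first letters are admitted when \<open>b = N\<close>, and then \<open>s\<^sub>b = V\<close>.\<close>

lemma word_series_identity:
  "lin_prod x (of_int t) N * (1 + fps_const (of_int t) * word_series x t N) =
   lin_prod x 1 N * (1 + word_series x t N)"
proof -
  let ?V = "word_series x t N"
  have "fps_const (of_int t) = 1 + fps_const (of_int t - 1 :: complex)"
    by (rule fps_ext) simp
  hence eq: "1 + fps_const (of_int t) * ?V = 1 + ?V + fps_const (of_int t - 1) * ?V"
    by (simp only: distrib_right mult_1_left add.assoc)
  show ?thesis
    unfolding eq using partial_sum_head_series[OF order_refl, of x t N]
    by (simp only: word_series_eq_sum_head_series[symmetric])
qed

definition psum :: "(nat \<Rightarrow> complex) \<Rightarrow> nat \<Rightarrow> nat \<Rightarrow> complex" where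
  "psum x N l = (\<Sum>i=1..N. x i ^ l)"

text \<open>The logarithm of \<open>\<Prod> (1 - t x\<^sub>i z) / (1 - x\<^sub>i z)\<close>.\<close>

definition log_series :: "(nat \<Rightarrow> complex) \<Rightarrow> complex \<Rightarrow> nat \<Rightarrow> complex fps" where
  "log_series x t N = Abs_fps (\<lambda>l. (1 - t ^ l) * psum x N l / of_nat l)"

lemma log_series_0 [simp]: "fps_nth (log_series x t N) 0 = 0"
  by (simp add: log_series_def)

lemma fps_geometric: "(1 - fps_const c * fps_X) * Abs_fps (\<lambda>n. c ^ n) = (1 :: complex fps)"
proof (rule fps_ext)
  fix n show "fps_nth ((1 - fps_const c * fps_X) * Abs_fps (\<lambda>n. c ^ n)) n = fps_nth (1 :: complex fps) n"
    by (cases n) (simp_all add: algebra_simps mult.assoc)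
qed

lemma deriv_lin_prod:
  "fps_deriv (lin_prod x c N) =
     - lin_prod x c N * (\<Sum>b=1..N. fps_const (c * x b) * Abs_fps (\<lambda>n. (c * x b) ^ n))"
proof (induction N)
  case (Suc N)
  let ?g = "Abs_fps (\<lambda>n. (c * x (Suc N)) ^ n)" and ?k = "fps_const (c * x (Suc N))"
  define S where "S = (\<Sum>b=1..N. fps_const (c * x b) * Abs_fps (\<lambda>n. (c * x b) ^ n))"
  have l: "lin_prod x c (Suc N) = lin_prod x c N * (1 - ?k * fps_X)"
    by (simp add: lin_prod_def)
  have S: "(\<Sum>b=1..Suc N. fps_const (c * x b) * Abs_fps (\<lambda>n. (c * x b) ^ n)) = S + ?k * ?g"
    by (simp add: S_def)
  have "fps_deriv (lin_prod x c (Suc N)) = - lin_prod x c N * S * (1 - ?k * fps_X) - lin_prod x c N * ?k"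
    unfolding l using Suc by (simp add: S_def algebra_simps)
  also have "\<dots> = - lin_prod x c N * S * (1 - ?k * fps_X) - lin_prod x c N * ?k * ((1 - ?k * fps_X) * ?g)"
    by (simp only: fps_geometric mult_1_right)
  also have "\<dots> = - lin_prod x c (Suc N) * (S + ?k * ?g)"
    unfolding l by (simp add: algebra_simps)
  finally show ?case unfolding S .
qed (simp add: lin_prod_def)

lemma deriv_log_series:
  "fps_deriv (log_series x t N) =
     (\<Sum>b=1..N. fps_const (1 * x b) * Abs_fps (\<lambda>n. (1 * x b) ^ n)) -
     (\<Sum>b=1..N. fps_const (t * x b) * Abs_fps (\<lambda>n. (t * x b) ^ n))"
proof (rule fps_ext)
  fix n
  have "of_nat (Suc n) \<noteq> (0::complex)" using of_nat_neq_0 by blast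
  then have "fps_nth (fps_deriv (log_series x t N)) n = (1 - t ^ Suc n) * psum x N (Suc n)"
    by (simp add: log_series_def del: of_nat_Suc power_Suc)
  then show "fps_nth (fps_deriv (log_series x t N)) n = fps_nth ((\<Sum>b=1..N. fps_const (1 * x b) * Abs_fps (\<lambda>n. (1 * x b) ^ n)) -
     (\<Sum>b=1..N. fps_const (t * x b) * Abs_fps (\<lambda>n. (t * x b) ^ n))) n"
    by (simp add: psum_def fps_sum_nth sum_distrib_left sum_subtractf[symmetric]
          algebra_simps power_mult_distrib)
qed

lemma fps_eq_const_if_deriv_0:
  fixes f :: "complex fps" assumes "fps_deriv f = 0" shows "f = fps_const (fps_nth f 0)"
  by (rule iffD1[OF fps_deriv_eq_0_iff assms])

lemma lin_prod_0 [simp]: "fps_nth (lin_prod x c N) 0 = 1"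
  by (induction N) (simp_all add: lin_prod_def)

text \<open>Both sides have constant term \<open>1\<close>, so it suffices to compare logarithmic derivatives.  Those are
geometric series by \<open>deriv_lin_prod\<close> and \<open>deriv_log_series\<close>.\<close>

lemma exp_log_series:
  "lin_prod x 1 N * (fps_exp 1 oo log_series x t N) = lin_prod x t N"
proof -
  let ?E = "fps_exp 1 oo log_series x t N" and ?A = "lin_prod x 1 N" and ?B = "lin_prod x t N"
  define a where "a = (\<Sum>b=1..N. fps_const (1 * x b) * Abs_fps (\<lambda>n. (1 * x b) ^ n))"
  define b where "b = (\<Sum>b=1..N. fps_const (t * x b) * Abs_fps (\<lambda>n. (t * x b) ^ n))"
  have dE: "fps_deriv ?E = ?E * (a - b)"
    by (simp add: fps_compose_deriv deriv_log_series a_def b_def)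
  have dA: "fps_deriv ?A = - ?A * a" and dB: "fps_deriv ?B = - ?B * b"
    unfolding a_def b_def by (rule deriv_lin_prod)+
  define f where "f = ?A * ?E * inverse ?B"
  have B: "?B * inverse ?B = 1" by (simp add: inverse_mult_eq_1')
  have "fps_deriv (inverse ?B) = inverse ?B * b"
  proof -
    have "fps_deriv (?B * inverse ?B) = 0" unfolding B by simp
    hence "?B * fps_deriv (inverse ?B) = ?B * (inverse ?B * b)" by (simp add: dB algebra_simps)
    moreover have "?B \<noteq> 0" using lin_prod_0[of x t N] by force
    ultimately show ?thesis by simp
  qed
  hence "fps_deriv f = 0" by (simp add: f_def dA dE algebra_simps)
  hence "f = fps_const (fps_nth f 0)" by (rule fps_eq_const_if_deriv_0)
  also have "fps_nth f 0 = 1" by (simp add: f_def)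
  finally have "f = 1" by simp
  have "?A * ?E * (?B * inverse ?B) = f * ?B" by (simp only: f_def mult_ac)
  thus ?thesis unfolding B \<open>f = 1\<close> by simp
qed

text \<open>Dividing \<open>word_series_identity\<close> by \<open>\<Prod> (1 - x\<^sub>i z)\<close> gives \<open>E (1 + t V) = 1 + V\<close>, a linear equation for \<open>V\<close>.\<close>

lemma word_series_exp:
  fixes x :: "nat \<Rightarrow> complex" and N :: nat
  assumes "t \<noteq> 1"
  defines "E \<equiv> fps_exp 1 oo log_series x (of_int t) N"
  shows "(1 + word_series x t N) * (1 - fps_const (of_int t) * E) = fps_const (1 - of_int t) * E"
proof -
  let ?V = "word_series x t N" and ?A = "lin_prod x 1 N" and ?t = "fps_const (of_int t)"
  have "?A * (E * (1 + ?t * ?V)) = ?A * E * (1 + ?t * ?V)" by (rule mult.assoc[symmetric])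
  also have "?A * E = lin_prod x (of_int t) N" unfolding E_def by (rule exp_log_series)
  also have "lin_prod x (of_int t) N * (1 + ?t * ?V) = ?A * (1 + ?V)" by (rule word_series_identity)
  finally have "?A * (E * (1 + ?t * ?V)) = ?A * (1 + ?V)" .
  moreover have "?A \<noteq> 0"
  proof
    assume "?A = 0"
    thus False using lin_prod_0[of x 1 N] by simp
  qed
  ultimately have eq: "E * (1 + ?t * ?V) = 1 + ?V"
    by (rule mult_left_cancel[THEN iffD1, rotated])
  have "(1 + ?V) * (1 - ?t * E) = (1 + ?V) - (1 + ?V) * (?t * E)"
    by (simp only: right_diff_distrib mult_1_right)
  also have "\<dots> = E * (1 + ?t * ?V) - (1 + ?V) * (?t * E)" by (simp only: eq)
  also have "\<dots> = (1 - ?t) * E" by (simp only: algebra_simps) simp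
  also have "1 - ?t = fps_const (1 - of_int t)" by (rule fps_ext) simp
  finally show ?thesis .
qed

text \<open>Substituting \<open>y = log E\<close> into \<open>eulerian_egf_identity\<close> shows that both sides solve the same linear
equation, whose coefficient \<open>1 - t E\<close> is nonzero for \<open>t \<noteq> 1\<close>.\<close>

lemma word_series_eq_compose:
  fixes x :: "nat \<Rightarrow> complex"
  assumes "t \<noteq> 1"
  shows "1 + word_series x t N = eulerian_egf t oo log_series x (of_int t) N"
proof -
  let ?y = "log_series x (of_int t) N"
  let ?E = "fps_exp 1 oo ?y"
  have "(eulerian_egf t * (1 - fps_const (of_int t) * fps_exp 1)) oo ?y =
        (fps_const (1 - of_int t) * fps_exp 1) oo ?y"
    unfolding eulerian_egf_identity[OF assms] ..
  hence "(eulerian_egf t oo ?y) * (1 - fps_const (of_int t) * ?E) = fps_const (1 - of_int t) * ?E"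
    by (simp only: fps_compose_mult_distrib[OF log_series_0] fps_compose_sub_distrib
          fps_const_compose fps_compose_1)
  hence "(eulerian_egf t oo ?y) * (1 - fps_const (of_int t) * ?E) =
         (1 + word_series x t N) * (1 - fps_const (of_int t) * ?E)"
    using word_series_exp[OF assms, of x N] by simp
  moreover have "1 - fps_const (of_int t) * ?E \<noteq> 0"
  proof
    assume "1 - fps_const (of_int t) * ?E = 0"
    from arg_cong[OF this, of "\<lambda>f. fps_nth f 0"] have "(1 - of_int t :: complex) = 0" by simp
    thus False using assms by simp
  qed
  ultimately show ?thesis by simp
qed

lemma fps_power_nth_lists:
  "fps_nth (f ^ k) m = (\<Sum>v | length v = k \<and> sum_list v = m. prod_list (map (fps_nth f) v))"
  for f :: "'a :: comm_ring_1 fps"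
proof (cases k)
  case 0
  have "{v :: nat list. length v = 0 \<and> sum_list v = m} = (if m = 0 then {[]} else {})" by auto
  thus ?thesis using 0 by simp
next
  case (Suc k')
  show ?thesis
    unfolding fps_power_nth natpermute_def using Suc
    by (auto intro!: sum.cong simp: prod.list_conv_set_nth atLeast0LessThan lessThan_Suc_atMost atLeast0AtMost)
qed

text \<open>The compositions of \<open>m\<close> into \<open>k\<close> positive parts are grouped by their weakly decreasing
rearrangement.\<close>

lemma fps_power_nth_partitions:
  fixes f :: "'a :: comm_ring_1 fps"
  assumes f0: "fps_nth f 0 = 0"
  shows "fps_nth (f ^ k) m = (\<Sum>\<nu> | is_partition m \<nu> \<and> length \<nu> = k.
           of_nat (card (permutations_of_multiset (mset \<nu>))) * prod_list (map (fps_nth f) \<nu>))"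
proof -
  define S where "S = {v. length v = k \<and> sum_list v = m \<and> 0 \<notin> set v}"
  define T where "T = {\<nu>. is_partition m \<nu> \<and> length \<nu> = k}"
  have fin0: "finite {v. length v = k \<and> sum_list v = m}"
    by (rule finite_subset[of _ "{v. set v \<subseteq> {..m} \<and> length v = k}"])
       (auto intro: member_le_sum_list finite_lists_length_eq)
  have finS: "finite S" unfolding S_def by (rule finite_subset[OF _ fin0]) auto
  have finT: "finite T" unfolding T_def by (rule finite_subset[OF _ finite_partitions[of m]]) auto
  have g: "rev (sort v) \<in> T" if "v \<in> S" for v
  proof -
    have "sum_list (rev (sort v)) = sum_list v"
      using sum_mset_sum_list[of "sort v"] sum_mset_sum_list[of v] by (simp add: sum_list_rev)
    thus ?thesis using that
      by (auto simp: S_def T_def is_partition_def sorted_wrt_rev Suc_le_eq intro!: Nat.gr0I)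
  qed
  have fiber: "{v \<in> S. rev (sort v) = \<nu>} = permutations_of_multiset (mset \<nu>)" if \<nu>: "\<nu> \<in> T" for \<nu>
  proof (intro equalityI subsetI)
    fix v assume "v \<in> {v \<in> S. rev (sort v) = \<nu>}"
    thus "v \<in> permutations_of_multiset (mset \<nu>)" by (auto intro!: permutations_of_multisetI)
  next
    fix v assume "v \<in> permutations_of_multiset (mset \<nu>)"
    hence mv: "mset v = mset \<nu>" by (rule permutations_of_multisetD)
    have "sorted (rev \<nu>)" using \<nu> by (simp add: T_def is_partition_def sorted_wrt_rev)
    hence "sort v = rev \<nu>" using mv by (metis mset_rev properties_for_sort)
    moreover have "length v = length \<nu>" "sum_list v = sum_list \<nu>" "set v = set \<nu>"
      using mv by (metis size_mset, metis sum_mset_sum_list, metis set_mset_mset)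
    ultimately show "v \<in> {v \<in> S. rev (sort v) = \<nu>}"
      using \<nu> by (auto simp: S_def T_def is_partition_def)
  qed
  have "fps_nth (f ^ k) m = (\<Sum>v\<in>S. prod_list (map (fps_nth f) v))"
    unfolding fps_power_nth_lists S_def
  proof (rule sum.mono_neutral_right[OF fin0])
    show "\<forall>v\<in>{v. length v = k \<and> sum_list v = m} - {v. length v = k \<and> sum_list v = m \<and> 0 \<notin> set v}.
        prod_list (map (fps_nth f) v) = 0"
      using f0 by (auto simp: in_set_conv_decomp)
  qed auto
  also have "\<dots> = (\<Sum>\<nu>\<in>T. \<Sum>v\<in>{v \<in> S. rev (sort v) = \<nu>}. prod_list (map (fps_nth f) v))"
    by (rule sum.group[symmetric, OF finS finT]) (use g in auto)
  also have "\<dots> = (\<Sum>\<nu>\<in>T. \<Sum>v\<in>permutations_of_multiset (mset \<nu>). prod_list (map (fps_nth f) \<nu>))"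
  proof (intro sum.cong refl)
    fix \<nu> v assume "\<nu> \<in> T" and "v \<in> permutations_of_multiset (mset \<nu>)"
    hence "mset v = mset \<nu>" by (simp add: permutations_of_multisetD)
    hence "mset (map (fps_nth f) v) = mset (map (fps_nth f) \<nu>)" by simp
    thus "prod_list (map (fps_nth f) v) = prod_list (map (fps_nth f) \<nu>)" by (metis prod_mset_prod_list)
  qed (rule fiber)
  finally show ?thesis by (simp add: T_def)
qed

lemma z_partition_eq: "z_partition \<nu> = prod_list \<nu> * (\<Prod>i\<in>set \<nu>. fact (count_list \<nu> i))"
proof -
  have "prod_list \<nu> = (\<Prod>i\<in>set \<nu>. i ^ count_list \<nu> i)"
    using prod_mset_multiplicity[of "mset \<nu>"] by (simp add: prod_mset_prod_list count_mset)
  thus ?thesis by (simp add: z_partition_def prod.distrib)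
qed

lemma card_permutations_times_z_partition:
  "card (permutations_of_multiset (mset \<nu>)) * z_partition \<nu> = fact (length \<nu>) * prod_list \<nu>"
  using card_permutations_of_multiset_aux[of "mset \<nu>"]
  by (simp add: z_partition_eq count_mset mult.left_commute)

lemma z_partition_pos: "\<forall>l\<in>set \<nu>. 1 \<le> l \<Longrightarrow> 0 < z_partition \<nu>"
  unfolding z_partition_def by (intro prod_pos) (auto simp: Suc_le_eq)

lemma q_int_mult: "of_int (poly (q_int l) t) * (1 - of_int t) = (1 - of_int t ^ l :: complex)"
  by (simp add: q_int_def poly_sum poly_monom one_diff_power_eq mult.commute)

lemma log_series_coeff_prod:
  assumes "\<forall>l\<in>set \<nu>. 1 \<le> l"
  shows "of_nat (prod_list \<nu>) * prod_list (map (fps_nth (log_series x (of_int t) N)) \<nu>) =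
     (1 - of_int t) ^ length \<nu> * of_int (poly (prod_list (map q_int \<nu>)) t) * prod_list (map (psum x N) \<nu>)"
  using assms
proof (induction \<nu>)
  case (Cons l \<nu>)
  have "of_nat l * fps_nth (log_series x (of_int t) N) l =
        (1 - of_int t) * of_int (poly (q_int l) t) * psum x N l"
    using Cons.prems by (simp add: log_series_def q_int_mult[symmetric] mult_ac)
  hence "(of_nat l * fps_nth (log_series x (of_int t) N) l) *
      (of_nat (prod_list \<nu>) * prod_list (map (fps_nth (log_series x (of_int t) N)) \<nu>)) =
      ((1 - of_int t) * of_int (poly (q_int l) t) * psum x N l) *
      ((1 - of_int t) ^ length \<nu> * of_int (poly (prod_list (map q_int \<nu>)) t) * prod_list (map (psum x N) \<nu>))"
    using Cons by simp
  thus ?case by (simp add: mult_ac)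
qed simp

text \<open>The coefficient of \<open>z^m\<close> in \<open>\<Sum>\<^sub>k a\<^sub>k y^k / k!\<close>, where \<open>a\<^sub>k = A\<^sub>k(t) / (1 - t)^k\<close> and
\<open>y = \<Sum>\<^sub>l (1 - t^l) p\<^sub>l z^l / l\<close>.  The \<open>k\<close> factors \<open>1 - t\<close> that \<open>1 - t^l = (1 - t) [l]\<^sub>t\<close> supplies cancel the
denominator of \<open>a\<^sub>k\<close>, and \<open>k!\<close> over the number of arrangements of \<open>\<nu>\<close>, times the product of its
parts, is \<open>z\<^sub>\<nu>\<close>.\<close>

lemma sum_word_weight:
  assumes "t \<noteq> 1" "1 \<le> m"
  shows "(\<Sum>w\<in>words N m. word_weight x t w) =
    (\<Sum>\<nu> | is_partition m \<nu>. of_int (poly (eulerian_poly (length \<nu>) * prod_list (map q_int \<nu>)) t) /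
       of_nat (z_partition \<nu>) * prod_list (map (psum x N) \<nu>))"
    (is "_ = (\<Sum>\<nu> | is_partition m \<nu>. ?R \<nu>)")
proof -
  let ?y = "log_series x (of_int t) N"
  define u where "u = (1 - of_int t :: complex)"
  have u: "u \<noteq> 0" using assms by (simp add: u_def)
  have len: "length \<nu> \<le> m" if "is_partition m \<nu>" for \<nu>
  proof -
    have "\<forall>i\<in>set \<nu>. 1 \<le> i \<Longrightarrow> length \<nu> \<le> sum_list \<nu>" by (induction \<nu>) auto
    thus ?thesis using that by (simp add: is_partition_def)
  qed
  have "(\<Sum>w\<in>words N m. word_weight x t w) = fps_nth (1 + word_series x t N) m"
    using assms(2) by (simp add: word_series_def)
  also have "\<dots> = (\<Sum>k=0..m. fps_nth (eulerian_egf t) k * fps_nth (?y ^ k) m)"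
    unfolding word_series_eq_compose[OF assms(1)] fps_compose_nth ..
  also have "\<dots> = (\<Sum>k=0..m. \<Sum>\<nu> | \<nu> \<in> {\<nu>. is_partition m \<nu>} \<and> length \<nu> = k. ?R \<nu>)"
    unfolding fps_power_nth_partitions[OF log_series_0] sum_distrib_left mem_Collect_eq
  proof (intro sum.cong refl)
    fix k \<nu> assume \<nu>: "\<nu> \<in> {\<nu>. is_partition m \<nu> \<and> length \<nu> = k}"
    hence pos: "\<forall>l\<in>set \<nu>. 1 \<le> l" and k: "length \<nu> = k" by (auto simp: is_partition_def)
    let ?C = "of_nat (card (permutations_of_multiset (mset \<nu>))) :: complex"
    let ?z = "of_nat (z_partition \<nu>) :: complex" and ?p = "of_nat (prod_list \<nu>) :: complex"
    let ?L = "prod_list (map (fps_nth ?y) \<nu>)"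
    define A where "A = (of_int (poly (eulerian_poly k) t) :: complex)"
    define Q where "Q = (of_int (poly (prod_list (map q_int \<nu>)) t) :: complex)"
    define P where "P = prod_list (map (psum x N) \<nu>)"
    have z: "?z \<noteq> 0" using z_partition_pos[OF pos] by simp
    have p: "?p \<noteq> 0" using pos by (auto simp: prod_list_zero_iff)
    have "?C * ?z = fact k * ?p"
      using arg_cong[OF card_permutations_times_z_partition[of \<nu>], of "of_nat :: nat \<Rightarrow> complex"] k by simp
    moreover have "?p * ?L = u ^ k * Q * P"
      using log_series_coeff_prod[OF pos, of x t N] k by (simp add: u_def Q_def P_def)
    ultimately have "?C * ?L * ?z = fact k * (u ^ k * Q * P)" by (metis mult.assoc mult.commute)
    hence "?C * ?L = fact k * (u ^ k * Q * P) / ?z" using z by (simp add: field_simps)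
    hence "A / (u ^ k * fact k) * (?C * ?L) = A * Q / ?z * P" using u by simp
    thus "fps_nth (eulerian_egf t) k * (?C * ?L) = ?R \<nu>"
      by (simp add: eulerian_egf_def A_def Q_def P_def u_def k)
  qed
  also have "\<dots> = (\<Sum>\<nu> | is_partition m \<nu>. ?R \<nu>)"
    by (rule sum.group) (use len finite_partitions[of m] in auto)
  finally show ?thesis .
qed

section \<open>From values to coefficients\<close>

definition monomial_eval :: "(nat \<Rightarrow> complex) \<Rightarrow> nat \<Rightarrow> (nat \<Rightarrow>\<^sub>0 nat) \<Rightarrow> complex" where
  "monomial_eval x N e = (\<Prod>i\<le>N. x i ^ Poly_Mapping.lookup e i)"

lemma monomial_eval_0 [simp]: "monomial_eval x N 0 = 1"
  by (simp add: monomial_eval_def)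

lemma monomial_eval_add: "monomial_eval x N (a + b) = monomial_eval x N a * monomial_eval x N b"
  by (simp add: monomial_eval_def lookup_add power_add prod.distrib)

lemma monomial_eval_single: "i \<le> N \<Longrightarrow> monomial_eval x N (Poly_Mapping.single i l) = x i ^ l"
  unfolding monomial_eval_def
  by (subst prod.remove[of _ i]) (auto simp: lookup_single when_def intro!: prod.neutral)

definition content :: "nat list \<Rightarrow> (nat \<Rightarrow>\<^sub>0 nat)" where
  "content w = sum_list (map (\<lambda>a. Poly_Mapping.single a 1) w)"

lemma content_Cons: "content (a # w) = Poly_Mapping.single a 1 + content w"
  by (simp add: content_def)

lemma monomial_eval_content:
  "set w \<subseteq> {1..N} \<Longrightarrow> monomial_eval x N (content w) = prod_list (map x w)"
  by (induction w) (auto simp: content_def monomial_eval_add monomial_eval_single)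

lemma prod_psum_eq_sum_words:
  "prod_list (map (psum x N) \<nu>) =
     (\<Sum>b\<in>words N (length \<nu>). monomial_eval x N (term_exponent \<nu> b))"
proof (induction \<nu>)
  case (Cons l \<nu>)
  have "prod_list (map (psum x N) (l # \<nu>)) =
     (\<Sum>i=1..N. \<Sum>b\<in>words N (length \<nu>). x i ^ l * monomial_eval x N (term_exponent \<nu> b))"
    by (simp add: Cons.IH psum_def sum_product)
  also have "\<dots> = (\<Sum>b\<in>words N (length (l # \<nu>)). monomial_eval x N (term_exponent (l # \<nu>) b))"
    unfolding length_Cons sum_words_Suc
    by (intro sum.cong refl) (simp add: monomial_eval_add monomial_eval_single)
  finally show ?case .
qed simp

lemma base_expansion_unique:
  fixes a b :: "nat \<Rightarrow> nat"
  assumes "(\<Sum>i<n. a i * B ^ i) = (\<Sum>i<n. b i * B ^ i)" "\<And>i. i < n \<Longrightarrow> a i < B" "\<And>i. i < n \<Longrightarrow> b i < B"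
    and "i < n"
  shows "a i = b i"
  using assms
proof (induction n arbitrary: a b i)
  case (Suc n)
  have exp: "(\<Sum>i<Suc n. c i * B ^ i) = c 0 + B * (\<Sum>i<n. c (Suc i) * B ^ i)" for c :: "nat \<Rightarrow> nat"
    by (simp add: sum.lessThan_Suc_shift sum_distrib_left mult_ac del: sum.lessThan_Suc)
  have eq: "a 0 + B * (\<Sum>i<n. a (Suc i) * B ^ i) = b 0 + B * (\<Sum>i<n. b (Suc i) * B ^ i)"
    using Suc.prems(1) unfolding exp .
  have ab: "a 0 < B" "b 0 < B" using Suc.prems by auto
  have 0: "a 0 = b 0" using arg_cong[OF eq, of "\<lambda>z. z mod B"] ab by simp
  hence "(\<Sum>i<n. a (Suc i) * B ^ i) = (\<Sum>i<n. b (Suc i) * B ^ i)" using eq ab by simp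
  hence "a (Suc j) = b (Suc j)" if "j < n" for j
    using Suc.IH[of "\<lambda>i. a (Suc i)" "\<lambda>i. b (Suc i)" j] Suc.prems that by simp
  with 0 Suc.prems(4) show ?case by (cases i) auto
qed simp

text \<open>Kronecker's substitution \<open>x\<^sub>i = y^(K^i)\<close>.  If \<open>K\<close> exceeds all exponents, distinct monomials become
distinct powers of \<open>y\<close>, and an identity between polynomial functions of the single variable \<open>y\<close>
can be compared coefficientwise.\<close>

lemma coeffs_eq_if_evals_eq:
  fixes c :: "'a \<Rightarrow> complex" and d :: "'b \<Rightarrow> complex"
  assumes A: "finite A" "\<And>a. a \<in> A \<Longrightarrow> Poly_Mapping.keys (wa a) \<subseteq> {..N}"
    and B: "finite B" "\<And>b. b \<in> B \<Longrightarrow> Poly_Mapping.keys (wb b) \<subseteq> {..N}"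
    and eval: "\<And>x. (\<Sum>a\<in>A. c a * monomial_eval x N (wa a)) = (\<Sum>b\<in>B. d b * monomial_eval x N (wb b))"
    and e: "Poly_Mapping.keys e \<subseteq> {..N}"
  shows "(\<Sum>a | a \<in> A \<and> wa a = e. c a) = (\<Sum>b | b \<in> B \<and> wb b = e. d b)"
proof -
  define X where "X = insert e (wa ` A \<union> wb ` B)"
  have finX: "finite X" using A B by (simp add: X_def)
  have keysX: "Poly_Mapping.keys f \<subseteq> {..N}" if "f \<in> X" for f using that A B e by (auto simp: X_def)
  define K where "K = Suc (Max ((\<lambda>(f, i). Poly_Mapping.lookup f i) ` (X \<times> {..N})))"
  have K: "Poly_Mapping.lookup f i < K" if "f \<in> X" "i \<le> N" for f i
    unfolding K_def less_Suc_eq_le using that finX by (intro Max_ge) auto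
  define \<kappa> where "\<kappa> f = (\<Sum>i<Suc N. Poly_Mapping.lookup f i * K ^ i)" for f :: "nat \<Rightarrow>\<^sub>0 nat"
  have inj: "f = g" if "f \<in> X" "g \<in> X" "\<kappa> f = \<kappa> g" for f g
  proof (rule poly_mapping_eqI)
    fix i show "Poly_Mapping.lookup f i = Poly_Mapping.lookup g i"
    proof (cases "i \<le> N")
      case True
      thus ?thesis
        using base_expansion_unique[OF that(3)[unfolded \<kappa>_def], of i] K[OF that(1)] K[OF that(2)] by simp
    next
      case False
      hence "i \<notin> Poly_Mapping.keys f" "i \<notin> Poly_Mapping.keys g" using keysX that by (meson atMost_iff subsetD)+
      thus ?thesis by (simp add: in_keys_iff)
    qed
  qed
  have ev: "monomial_eval (\<lambda>i. y ^ (K ^ i)) N f = y ^ \<kappa> f" for y f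
    unfolding monomial_eval_def \<kappa>_def lessThan_Suc_atMost
    by (simp add: power_sum flip: power_mult) (simp add: mult.commute)
  let ?p = "\<Sum>a\<in>A. monom (c a) (\<kappa> (wa a))" and ?q = "\<Sum>b\<in>B. monom (d b) (\<kappa> (wb b))"
  have "poly ?p y = poly ?q y" for y
    using eval[of "\<lambda>i. y ^ (K ^ i)"] unfolding ev by (simp add: poly_sum poly_monom)
  hence "?p = ?q" by (simp flip: poly_eq_poly_eq_iff add: fun_eq_iff)
  hence "poly.coeff ?p (\<kappa> e) = poly.coeff ?q (\<kappa> e)" by simp
  moreover have "\<kappa> (wa a) = \<kappa> e \<longleftrightarrow> wa a = e" if "a \<in> A" for a using inj[of "wa a" e] that by (auto simp: X_def)
  moreover have "\<kappa> (wb b) = \<kappa> e \<longleftrightarrow> wb b = e" if "b \<in> B" for b using inj[of "wb b" e] that by (auto simp: X_def)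
  ultimately have "(\<Sum>a\<in>A. if wa a = e then c a else 0) = (\<Sum>b\<in>B. if wb b = e then d b else 0)"
    by (simp add: coeff_sum cong: sum.cong)
  thus ?thesis using A(1) B(1) by (simp add: sum.If_cases Int_def)
qed

lemma keys_single_add:
  "1 \<le> l \<Longrightarrow> Poly_Mapping.keys (Poly_Mapping.single i l + f) = insert i (Poly_Mapping.keys f)"
  for f :: "nat \<Rightarrow>\<^sub>0 nat"
  by (auto simp: in_keys_iff lookup_add lookup_single when_def split: if_splits)

lemma keys_content: "Poly_Mapping.keys (content w) = set w"
  by (induction w) (simp_all add: content_Cons keys_single_add, simp add: content_def)

lemma keys_term_exponent: "Poly_Mapping.keys (term_exponent \<nu> b) \<subseteq> set b"
  using lookup_term_exponent_notin[of _ b \<nu>] by (auto simp: in_keys_iff)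

lemma keys_term_exponent_eq:
  "length b = length \<nu> \<Longrightarrow> \<forall>l\<in>set \<nu>. 1 \<le> l \<Longrightarrow> Poly_Mapping.keys (term_exponent \<nu> b) = set b"
proof (induction b \<nu> rule: list_induct2)
  case (Cons i b l \<nu>)
  have "Poly_Mapping.keys (Poly_Mapping.single i l + term_exponent \<nu> b) =
        insert i (Poly_Mapping.keys (term_exponent \<nu> b))"
    using Cons.prems by (auto simp: in_keys_iff lookup_add lookup_single when_def split: if_splits)
  thus ?case using Cons by simp
qed simp

lemma sum_word_poly_eval:
  assumes t: "t \<noteq> 1" and m: "1 \<le> m" and e: "Poly_Mapping.keys e \<subseteq> {1..N}"
  shows "of_int (poly (\<Sum>w | w \<in> words N m \<and> content w = e. word_poly w) t) =
    (\<Sum>\<nu> | is_partition m \<nu>. power_sum_partition \<nu> e / of_nat (z_partition \<nu>) *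
       of_int (poly (eulerian_poly (length \<nu>) * prod_list (map q_int \<nu>)) t))"
proof -
  let ?c = "\<lambda>\<nu>. of_int (poly (eulerian_poly (length \<nu>) * prod_list (map q_int \<nu>)) t) / of_nat (z_partition \<nu>) :: complex"
  let ?B = "SIGMA \<nu>:{\<nu>. is_partition m \<nu>}. words N (length \<nu>)"
  have finB: "finite ?B" using finite_partitions[of m] by auto
  have eval: "(\<Sum>w\<in>words N m. of_int (poly (word_poly w) t) * monomial_eval x N (content w)) =
        (\<Sum>p\<in>?B. ?c (fst p) * monomial_eval x N (term_exponent (fst p) (snd p)))" for x
  proof -
    have "(\<Sum>w\<in>words N m. of_int (poly (word_poly w) t) * monomial_eval x N (content w)) =
          (\<Sum>w\<in>words N m. word_weight x t w)"
      by (intro sum.cong refl) (simp add: word_weight_def words_def monomial_eval_content)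
    also have "\<dots> = (\<Sum>\<nu> | is_partition m \<nu>. \<Sum>b\<in>words N (length \<nu>). ?c \<nu> * monomial_eval x N (term_exponent \<nu> b))"
      unfolding sum_word_weight[OF t m] prod_psum_eq_sum_words sum_distrib_left ..
    also have "\<dots> = (\<Sum>(\<nu>, b)\<in>?B. ?c \<nu> * monomial_eval x N (term_exponent \<nu> b))"
      by (rule sum.Sigma) (simp_all add: finite_partitions)
    finally show ?thesis by (simp add: case_prod_unfold)
  qed
  have "(\<Sum>w | w \<in> words N m \<and> content w = e. of_int (poly (word_poly w) t)) =
        (\<Sum>p | p \<in> ?B \<and> term_exponent (fst p) (snd p) = e. ?c (fst p))"
  proof (rule coeffs_eq_if_evals_eq[where N = N, OF finite_words _ finB _ eval])
    fix p assume "p \<in> ?B"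
    hence "set (snd p) \<subseteq> {..N}" by (auto simp: words_def)
    thus "Poly_Mapping.keys (term_exponent (fst p) (snd p)) \<subseteq> {..N}"
      using keys_term_exponent by blast
  qed (use e in \<open>auto simp: keys_content words_def\<close>)
  also have "{p. p \<in> ?B \<and> term_exponent (fst p) (snd p) = e} =
     (SIGMA \<nu>:{\<nu>. is_partition m \<nu>}. power_sum_terms \<nu> e)"
  proof -
    have iff: "b \<in> words N (length \<nu>) \<and> term_exponent \<nu> b = e \<longleftrightarrow> b \<in> power_sum_terms \<nu> e"
      if "is_partition m \<nu>" for \<nu> b
      using keys_term_exponent_eq[of b \<nu>] that e
      by (auto simp: words_def power_sum_terms_def is_partition_def)
    have "p \<in> {p. p \<in> ?B \<and> term_exponent (fst p) (snd p) = e} \<longleftrightarrow>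
          p \<in> (SIGMA \<nu>:{\<nu>. is_partition m \<nu>}. power_sum_terms \<nu> e)" for p
      using iff[of "fst p" "snd p"] by (cases p) auto
    thus ?thesis by blast
  qed
  also have "(\<Sum>p\<in>(SIGMA \<nu>:{\<nu>. is_partition m \<nu>}. power_sum_terms \<nu> e). ?c (fst p)) =
     (\<Sum>\<nu> | is_partition m \<nu>. \<Sum>b\<in>power_sum_terms \<nu> e. ?c \<nu>)"
    by (subst sum.Sigma) (auto simp: finite_partitions case_prod_unfold is_partition_def power_sum_terms_card)
  also have "\<dots> = (\<Sum>\<nu> | is_partition m \<nu>. power_sum_partition \<nu> e / of_nat (z_partition \<nu>) *
       of_int (poly (eulerian_poly (length \<nu>) * prod_list (map q_int \<nu>)) t))"
    by (intro sum.cong refl) (simp add: is_partition_def power_sum_terms_card)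
  finally show ?thesis by (simp add: poly_sum)
qed

lemma poly_map_poly_of_int: "poly (map_poly of_int p) (of_int t) = (of_int (poly p t) :: complex)"
  by (induction p) (simp_all add: map_poly_pCons)

text \<open>For a fixed monomial \<open>e\<close>, both sides of \<open>sum_word_poly_eval\<close> are polynomials in \<open>t\<close> that agree at
every integer \<open>t \<noteq> 1\<close>.\<close>

lemma sum_word_poly_coeff:
  assumes m: "1 \<le> m" and e: "Poly_Mapping.keys e \<subseteq> {1..N}"
  shows "of_int (poly.coeff (\<Sum>w | w \<in> words N m \<and> content w = e. word_poly w) i) =
    (\<Sum>\<nu> | is_partition m \<nu>. power_sum_partition \<nu> e / of_nat (z_partition \<nu>) *
       of_int (poly.coeff (eulerian_poly (length \<nu>) * prod_list (map q_int \<nu>)) i))"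
proof -
  let ?r = "\<lambda>\<nu>. eulerian_poly (length \<nu>) * prod_list (map q_int \<nu>)"
  let ?L = "map_poly of_int (\<Sum>w | w \<in> words N m \<and> content w = e. word_poly w) :: complex poly"
  let ?R = "\<Sum>\<nu> | is_partition m \<nu>. Polynomial.smult (power_sum_partition \<nu> e / of_nat (z_partition \<nu>)) (map_poly of_int (?r \<nu>))"
  have "poly (?L - ?R) (of_int t) = 0" if "t \<noteq> 1" for t
    using sum_word_poly_eval[OF that m e]
    by (simp add: poly_sum poly_map_poly_of_int del: poly_mult)
  hence "of_int ` (- {1}) \<subseteq> {z. poly (?L - ?R) z = 0}" by auto
  moreover have "infinite (of_int ` (- {1}) :: complex set)"
    by (subst finite_image_iff) (auto simp: inj_on_def infinite_UNIV_int finite_compl)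
  ultimately have "?L - ?R = 0" using poly_roots_finite[of "?L - ?R"] finite_subset by blast
  hence "poly.coeff ?L i = poly.coeff ?R i" by simp
  thus ?thesis by (simp add: coeff_map_poly coeff_sum)
qed

section \<open>Coloured words\<close>

text \<open>In a letter \<open>(a, c)\<close> of a coloured word, \<open>c\<close> tells whether \<open>a\<close> is barred.\<close>

definition step_ok :: "nat \<times> bool \<Rightarrow> nat \<times> bool \<Rightarrow> bool" where
  "step_ok x y \<longleftrightarrow> (if snd x then fst y \<le> fst x else fst x \<le> fst y)"

text \<open>The last letter has to be unbarred because a letter larger than all others, at which the circular
word was cut open, follows it.\<close>

fun coloured_word :: "(nat \<times> bool) list \<Rightarrow> bool" where
  "coloured_word [] \<longleftrightarrow> False"
| "coloured_word [x] \<longleftrightarrow> \<not> snd x"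
| "coloured_word (x # y # u) \<longleftrightarrow> step_ok x y \<and> coloured_word (y # u)"

lemma coloured_word_iff_nth:
  "coloured_word u \<longleftrightarrow> u \<noteq> [] \<and> \<not> snd (last u) \<and> (\<forall>i. Suc i < length u \<longrightarrow> step_ok (u ! i) (u ! Suc i))"
proof (induction u rule: coloured_word.induct)
  case (3 x y u)
  have "(\<forall>i. Suc i < length (x # y # u) \<longrightarrow> step_ok ((x # y # u) ! i) ((x # y # u) ! Suc i)) \<longleftrightarrow>
     step_ok x y \<and> (\<forall>i. Suc i < length (y # u) \<longrightarrow> step_ok ((y # u) ! i) ((y # u) ! Suc i))"
    by (simp add: All_less_Suc2)
  thus ?case using 3 by auto
qed auto

definition bars :: "(nat \<times> bool) list \<Rightarrow> nat" where
  "bars u = length (filter snd u)"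

lemma finite_colourings: "finite {u. map fst u = w \<and> P u}" for w :: "nat list" and P :: "(nat \<times> bool) list \<Rightarrow> bool"
proof (rule finite_subset)
  show "{u. map fst u = w \<and> P u} \<subseteq> {u. set u \<subseteq> set w \<times> UNIV \<and> length u = length w}" by force
qed (rule finite_lists_length_eq, simp)

text \<open>A bar is optional on a plateau, forced on a descent and forbidden on an ascent, and it weighs
\<open>t\<close>.  This is what the three values of \<^const>\<open>step_poly\<close> record.\<close>

lemma word_poly_eq_sum_colourings:
  assumes "w \<noteq> []"
  shows "word_poly w = (\<Sum>u | map fst u = w \<and> coloured_word u. monom 1 (bars u))"
  using assms
proof (induction w rule: word_poly.induct)
  case (2 a)
  have "{u. map fst u = [a] \<and> coloured_word u} = {[(a, False)]}"
    by (auto simp: map_eq_Cons_conv)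
  thus ?case by (simp add: bars_def monom_eq_1)
next
  case (3 a b w)
  let ?S = "{u. map fst u = b # w \<and> coloured_word u}"
  let ?up = "if a \<le> b then Cons (a, False) ` ?S else {}"
  let ?down = "if b \<le> a then Cons (a, True) ` ?S else {}"
  have fin: "finite ?S" by (rule finite_colourings)
  have "{u. map fst u = a # b # w \<and> coloured_word u} = ?up \<union> ?down"
    by (auto simp: map_eq_Cons_conv step_ok_def split: if_splits)
  hence "(\<Sum>u | map fst u = a # b # w \<and> coloured_word u. monom 1 (bars u)) =
         (\<Sum>u\<in>?up. monom 1 (bars u)) + (\<Sum>u\<in>?down. monom 1 (bars u))"
    using fin by (simp only:, intro sum.union_disjoint) auto
  also have "(\<Sum>u\<in>?up. monom (1::int) (bars u)) =
      (if a \<le> b then 1 else 0) * (\<Sum>u\<in>?S. monom 1 (bars u))"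
    by (simp add: sum.reindex bars_def)
  also have "(\<Sum>u\<in>?down. monom (1::int) (bars u)) =
      (if b \<le> a then monom 1 1 else 0) * (\<Sum>u\<in>?S. monom 1 (bars u))"
    by (simp add: sum.reindex bars_def sum_distrib_left mult_monom)
  finally show ?case using 3 by (simp add: step_poly_def distrib_right)
qed simp

definition coloured_words :: "nat \<Rightarrow> (nat \<Rightarrow>\<^sub>0 nat) \<Rightarrow> nat \<Rightarrow> (nat \<times> bool) list set" where
  "coloured_words m e k = {u. length u = m \<and> coloured_word u \<and> content (map fst u) = e \<and> bars u = k}"

lemma coeff_sum_word_poly:
  assumes m: "1 \<le> m" and e: "Poly_Mapping.keys e \<subseteq> {1..N}"
  shows "poly.coeff (\<Sum>w | w \<in> words N m \<and> content w = e. word_poly w) k = int (card (coloured_words m e k))"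
proof -
  let ?W = "{w. w \<in> words N m \<and> content w = e}"
  let ?U = "\<lambda>w. {u. map fst u = w \<and> coloured_word u \<and> bars u = k}"
  have finW: "finite ?W" by (rule finite_subset[OF _ finite_words[of N m]]) auto
  have "poly.coeff (word_poly w) k = int (card (?U w))" if "w \<in> ?W" for w
  proof -
    have "w \<noteq> []" using that m by (auto simp: words_def)
    hence "poly.coeff (word_poly w) k = (\<Sum>u | map fst u = w \<and> coloured_word u. if bars u = k then 1 else 0)"
      by (simp add: word_poly_eq_sum_colourings coeff_sum)
    also have "\<dots> = int (card (?U w))"
      using finite_colourings[of w coloured_word] by (simp add: sum.If_cases Int_def conj_ac)
    finally show ?thesis .
  qed
  hence "poly.coeff (\<Sum>w\<in>?W. word_poly w) k = int (\<Sum>w\<in>?W. card (?U w))"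
    by (simp add: coeff_sum)
  also have "(\<Sum>w\<in>?W. card (?U w)) = card (\<Union>w\<in>?W. ?U w)"
    using finW finite_colourings by (intro card_UN_disjoint[symmetric]) auto
  also have "(\<Union>w\<in>?W. ?U w) = coloured_words m e k"
    using e by (auto simp: coloured_words_def words_def simp flip: keys_content)
  finally show ?thesis .
qed

lemma content_map_fst_nth:
  "content (map fst u) = (\<Sum>p=1..length u. Poly_Mapping.single (fst (u ! (p - 1))) 1)"
proof -
  have "content (map fst u) = (\<Sum>p<length u. Poly_Mapping.single (fst (u ! p)) 1)"
    by (simp add: content_def sum_list_sum_nth atLeast0LessThan)
  also have "\<dots> = (\<Sum>p=1..length u. Poly_Mapping.single (fst (u ! (p - 1))) 1)"
    by (rule sum.reindex_bij_witness[of _ "\<lambda>p. p - 1" Suc]) auto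
  finally show ?thesis .
qed

lemma bars_nth: "bars u = card {p \<in> {1..length u}. snd (u ! (p - 1))}"
proof -
  have "bars u = card {p. p < length u \<and> snd (u ! p)}"
    by (simp add: bars_def length_filter_conv_card)
  also have "\<dots> = card {p \<in> {1..length u}. snd (u ! (p - 1))}"
    by (rule bij_betw_same_card, rule bij_betw_byWitness[of _ "\<lambda>p. p - 1" Suc]) auto
  finally show ?thesis .
qed

text \<open>The order in which the letters of an admissible sequence receive their positions: larger letters
first, and among equal letters the barred ones first.\<close>

definition letter_key :: "nat \<times> bool \<Rightarrow> int" where
  "letter_key x = (if snd x then 0 else 1) - 2 * int (fst x)"

lemma letter_key_less_iff:
  "letter_key x < letter_key y \<longleftrightarrow> fst y < fst x \<or> fst x = fst y \<and> snd x \<and> \<not> snd y"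
  by (auto simp: letter_key_def)

lemma letter_key_eq_iff: "letter_key x = letter_key y \<longleftrightarrow> x = y"
  by (cases x; cases y) (auto simp: letter_key_def, presburger+)

text \<open>Positions count from \<open>1\<close>.  Position \<open>length u + 1\<close>, whose suffix is empty, belongs to the largest
letter at which the circular word was cut; correspondingly the empty list is the least one in the
lexicographic order.\<close>

definition suffix_key :: "(nat \<times> bool) list \<Rightarrow> nat \<Rightarrow> int list" where
  "suffix_key u p = map letter_key (drop (p - 1) u)"

lemma suffix_key_end [simp]: "suffix_key u (Suc (length u)) = []"
  by (simp add: suffix_key_def)

lemma suffix_key_unfold:
  assumes "p \<in> {1..length u}"
  shows "suffix_key u p = letter_key (u ! (p - 1)) # suffix_key u (Suc p)"
  using assms by (cases p) (simp_all add: suffix_key_def Cons_nth_drop_Suc[symmetric])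

lemma inj_on_suffix_key: "inj_on (suffix_key u) {1..Suc (length u)}"
proof (rule inj_onI)
  fix p q assume pq: "p \<in> {1..Suc (length u)}" "q \<in> {1..Suc (length u)}" "suffix_key u p = suffix_key u q"
  have "length u - (p - 1) = length u - (q - 1)"
    using arg_cong[OF pq(3), of length] by (simp add: suffix_key_def)
  thus "p = q" using pq(1,2) by auto
qed

definition rank_in :: "'a set \<Rightarrow> ('a \<Rightarrow> 'b :: linorder) \<Rightarrow> 'a \<Rightarrow> nat" where
  "rank_in A f p = card {q \<in> A. f q \<le> f p}"

lemma rank_in_less_iff:
  assumes "finite A" "p \<in> A" "q \<in> A"
  shows "rank_in A f p < rank_in A f q \<longleftrightarrow> f p < f q"
proof
  assume "f p < f q"
  hence "{r \<in> A. f r \<le> f p} \<subset> {r \<in> A. f r \<le> f q}" using assms(3) by force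
  thus "rank_in A f p < rank_in A f q"
    unfolding rank_in_def using assms(1) by (intro psubset_card_mono) auto
next
  assume l: "rank_in A f p < rank_in A f q"
  show "f p < f q"
  proof (rule ccontr)
    assume "\<not> f p < f q"
    hence "{r \<in> A. f r \<le> f q} \<subseteq> {r \<in> A. f r \<le> f p}" by auto
    hence "rank_in A f q \<le> rank_in A f p"
      unfolding rank_in_def using assms(1) by (intro card_mono) auto
    thus False using l by simp
  qed
qed

lemma bij_betw_rank_in:
  assumes "finite A" "inj_on f A"
  shows "bij_betw (rank_in A f) A {1..card A}"
proof -
  have "inj_on (rank_in A f) A"
  proof (rule inj_onI)
    fix p q assume pq: "p \<in> A" "q \<in> A" "rank_in A f p = rank_in A f q"
    hence "\<not> f p < f q" "\<not> f q < f p" using rank_in_less_iff[OF assms(1)] by (metis less_irrefl)+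
    hence "f p = f q" by simp
    thus "p = q" using pq assms(2) by (simp add: inj_onD)
  qed
  moreover have "rank_in A f ` A \<subseteq> {1..card A}"
  proof (rule image_subsetI)
    fix p assume p: "p \<in> A"
    hence "rank_in A f p > 0" unfolding rank_in_def using assms(1) by (subst card_gt_0_iff) auto
    moreover have "rank_in A f p \<le> card A" unfolding rank_in_def using assms(1) by (intro card_mono) auto
    ultimately show "rank_in A f p \<in> {1..card A}" by simp
  qed
  ultimately show ?thesis
    by (metis bij_betw_imp_surj_on bij_betw_def card_atLeastAtMost card_image card_subset_eq diff_Suc_1 finite_atLeastAtMost)
qed

text \<open>The only order preserving numbering of a finite set is the one by ranks.\<close>

lemma rank_in_eq_if_order_embedding:
  assumes g: "bij_betw g A {1..n}" and less: "\<And>p q. p \<in> A \<Longrightarrow> q \<in> A \<Longrightarrow> f p < f q \<Longrightarrow> g p < (g q :: nat)"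
    and f: "inj_on f A" and p: "p \<in> A"
  shows "rank_in A f p = g p"
proof -
  have iff: "f q \<le> f p \<longleftrightarrow> g q \<le> g p" if "q \<in> A" for q
    using less[of q p] less[of p q] that p by (metis inj_onD f le_less not_le order.asym)
  have "rank_in A f p = card {q \<in> A. g q \<le> g p}" unfolding rank_in_def using iff by (metis (mono_tags, lifting))
  also have "\<dots> = card {1..g p}"
  proof (rule bij_betw_same_card[of g])
    have "g ` {q \<in> A. g q \<le> g p} = {i \<in> g ` A. i \<le> g p}" by auto
    also have "\<dots> = {1..g p}"
      using bij_betw_imp_surj_on[OF g] bij_betw_apply[OF g p] by auto
    finally show "bij_betw g {q \<in> A. g q \<le> g p} {1..g p}"
      using g by (auto simp: bij_betw_def intro: inj_on_subset)
  qed
  finally show ?thesis by simp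
qed

section \<open>Reading a cycle as a coloured word\<close>

locale cycle_reading =
  fixes m n :: nat and \<sigma> :: "nat \<Rightarrow> nat"
  assumes n_eq: "n = Suc m" and m: "1 \<le> m" and perm: "\<sigma> permutes {1..n}" and cyc: "cyclic_on \<sigma> {1..n}"
begin

(* Inequalities serve as facts about n, because the equation would make the simplifier eliminate n. *)
lemma n: "m < n" "n \<le> Suc m"
  by (simp_all add: n_eq)

definition pos :: "nat \<Rightarrow> nat" where "pos p = (\<sigma> ^^ p) 1"

lemma pos_Suc: "pos (Suc p) = \<sigma> (pos p)"
  by (simp add: pos_def)

lemma pos_eq_iff: "pos p = pos q \<longleftrightarrow> p mod n = q mod n"
proof -
  have "orbit \<sigma> 1 = {1..n}" using cyc n_eq by (simp add: orbit_cyclic_eq3)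
  moreover have "permutation \<sigma>" using perm by (auto simp: permutation_permutes)
  ultimately show ?thesis unfolding pos_def by (simp add: funpow_eq_iff_mod_card_orbit)
qed

lemma pos_n [simp]: "pos n = 1"
  using pos_eq_iff[of n 0] by (simp add: pos_def)

lemma bij_pos: "bij_betw pos {1..n} {1..n}"
proof -
  have "inj_on pos {1..n}"
  proof (rule inj_onI)
    fix p q assume "p \<in> {1..n}" "q \<in> {1..n}" "pos p = pos q"
    thus "p = q" unfolding pos_eq_iff by (cases "p = n"; cases "q = n") auto
  qed
  moreover have "pos p \<in> {1..n}" for p
    unfolding pos_def by (induction p) (use permutes_in_image[OF perm] n in auto)
  hence "pos ` {1..n} \<subseteq> {1..n}" by auto
  ultimately show ?thesis by (simp add: bij_betw_def endo_inj_surj)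
qed

lemma pos_in: "p \<in> {1..n} \<Longrightarrow> pos p \<in> {1..n}"
  using bij_betw_apply[OF bij_pos] .

lemma pos_inj: "p \<in> {1..n} \<Longrightarrow> q \<in> {1..n} \<Longrightarrow> pos p = pos q \<Longrightarrow> p = q"
  using bij_pos by (auto simp: bij_betw_def dest: inj_onD)

lemma pos_1: "1 < pos 1"
proof -
  have "pos 1 \<noteq> pos n" using pos_inj[of 1 n] n m by auto
  moreover have "pos 1 \<in> {1..n}" using n by (intro pos_in) auto
  ultimately show ?thesis by auto
qed

text \<open>The cycle is read from \<open>\<sigma> 1\<close> up to the predecessor of \<open>1\<close>; the entry at \<open>1\<close> itself is left out.\<close>

definition reading :: "(nat \<Rightarrow> nat) \<Rightarrow> (nat \<times> bool) list" where
  "reading s = map (\<lambda>p. (s (pos p), pos p < pos (Suc p))) [1..<n]"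

lemma length_reading [simp]: "length (reading s) = m"
  using n by (simp add: reading_def)

lemma nth_reading: "p \<in> {1..m} \<Longrightarrow> reading s ! (p - 1) = (s (pos p), pos p < pos (Suc p))"
  using n unfolding reading_def by (subst nth_map) auto

lemma suffix_key_reading_n: "suffix_key (reading s) n = []"
  using suffix_key_end[of "reading s"] by (simp add: n_eq[symmetric])

text \<open>The additional excedance is \<open>1\<close>, which no \<open>n\<close>-cycle with \<open>n > 1\<close> fixes.\<close>

lemma exc_eq: "exc n \<sigma> = Suc (bars (reading s))"
proof -
  have "exc n \<sigma> = card {i \<in> {1..n}. i < \<sigma> i}" by (simp add: exc_def EXC_permutes[OF perm])
  also have "\<dots> = card (pos ` {p \<in> {1..n}. pos p < pos (Suc p)})"
    by (subst (1) bij_betw_imp_surj_on[OF bij_pos, symmetric]) (auto simp: pos_Suc intro!: arg_cong[of _ _ card])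
  also have "\<dots> = card {p \<in> {1..n}. pos p < pos (Suc p)}"
    by (intro card_image inj_on_subset[OF bij_betw_imp_inj_on[OF bij_pos]]) auto
  also have "{p \<in> {1..n}. pos p < pos (Suc p)} = insert n {p \<in> {1..m}. pos p < pos (Suc p)}"
  proof -
    have "pos (Suc n) = pos 1" using pos_eq_iff[of "Suc n" 1] by (simp add: mod_Suc)
    hence "pos n < pos (Suc n)" using pos_1 by simp
    thus ?thesis using n by auto
  qed
  also have "card \<dots> = Suc (card {p \<in> {1..m}. pos p < pos (Suc p)})" using n by simp
  also have "{p \<in> {1..m}. pos p < pos (Suc p)} = {p \<in> {1..length (reading s)}. snd (reading s ! (p - 1))}"
    by (auto simp: nth_reading simp del: One_nat_def)
  finally show ?thesis by (simp only: bars_nth)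
qed

lemma content_reading:
  "(\<Sum>k=1..n. Poly_Mapping.single (s k) 1) = content (map fst (reading s)) + Poly_Mapping.single (s 1) 1"
proof -
  have "(\<Sum>k=1..n. Poly_Mapping.single (s k) (1::nat)) = (\<Sum>p=1..n. Poly_Mapping.single (s (pos p)) 1)"
    by (rule sum.reindex_bij_betw[OF bij_pos, symmetric])
  also have "\<dots> = (\<Sum>p=1..m. Poly_Mapping.single (s (pos p)) 1) + Poly_Mapping.single (s 1) (1::nat)"
  proof -
    have "{1..n} = insert n {1..m}" using n by auto
    thus ?thesis using n by (simp add: add.commute)
  qed
  also have "(\<Sum>p=1..m. Poly_Mapping.single (s (pos p)) 1) = content (map fst (reading s))"
    unfolding content_map_fst_nth length_reading
    by (intro sum.cong refl) (simp add: nth_reading del: One_nat_def)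
  finally show ?thesis .
qed

lemma bar_word_pos:
  assumes "p \<in> {1..n}"
  shows "bar_word n \<sigma> (pos p) = (if pos p < pos (Suc p) then Bar (pos (Suc p)) else Plain (pos (Suc p)))"
  using pos_in[OF assms] by (simp add: bar_word_def EXC_permutes[OF perm] pos_Suc)

lemma pos_surj: assumes "i \<in> {1..n}" obtains p where "p \<in> {1..n}" "i = pos p"
  using assms bij_betw_imp_surj_on[OF bij_pos] by blast

end

lemma letter_less_trans: "letter_less a b \<Longrightarrow> letter_less b c \<Longrightarrow> letter_less a c"
  by (cases a; cases b; cases c) auto

locale cycle_seq = cycle_reading +
  fixes s :: "nat \<Rightarrow> nat"
  assumes s: "s \<in> fund_seqs (DEX n \<sigma>) n"
begin

lemma s_antimono:
  assumes "1 \<le> i" "i \<le> k" "k \<le> n"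
  shows "s k \<le> s i"
  using assms(2,3)
proof (induction k rule: dec_induct)
  case (step k)
  have "s (Suc k) \<le> s k" using s step assms(1) by (auto simp: fund_seqs_def)
  thus ?case using step by simp
qed simp

lemma bar_word_less_step:
  assumes "i \<in> {1..<n}" "s i = s (Suc i)"
  shows "letter_less (bar_word n \<sigma> i) (bar_word n \<sigma> (Suc i))"
proof -
  have "i \<notin> DEX n \<sigma>" using s assms(2) by (auto simp: fund_seqs_def)
  hence "\<not> letter_less (bar_word n \<sigma> (Suc i)) (bar_word n \<sigma> i)" using assms(1) by (simp add: DEX_def)
  moreover have "\<sigma> i \<noteq> \<sigma> (Suc i)" using injD[OF permutes_inj[OF perm], of i "Suc i"] by auto
  ultimately show ?thesis by (auto simp: bar_word_def split: if_splits)
qed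

text \<open>On a run of equal values the sequence does not descend strictly, so the run contains no element of
\<^const>\<open>DEX\<close> and the barred word increases along it.\<close>

lemma bar_word_less:
  assumes "1 \<le> i" "i < k" "k \<le> n" "s i = s k"
  shows "letter_less (bar_word n \<sigma> i) (bar_word n \<sigma> k)"
proof -
  have "Suc i \<le> k" using assms(2) by simp
  thus ?thesis
    using assms(3,4)
  proof (induction k rule: dec_induct)
    case base
    thus ?case using assms(1) bar_word_less_step[of i] by simp
  next
    case (step k)
    have "s (Suc k) \<le> s k" by (rule s_antimono) (use step assms(1) in auto)
    moreover have "s k \<le> s i" by (rule s_antimono) (use step assms(1) in auto)
    ultimately have eq: "s i = s k" "s k = s (Suc k)" using step.prems by auto
    have "letter_less (bar_word n \<sigma> i) (bar_word n \<sigma> k)" using step eq by simp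
    moreover have "letter_less (bar_word n \<sigma> k) (bar_word n \<sigma> (Suc k))"
      using step assms(1) eq by (intro bar_word_less_step) auto
    ultimately show ?case by (rule letter_less_trans)
  qed
qed

lemma coloured_word_reading: "coloured_word (reading s)"
proof -
  have "pos (Suc m) = 1" using pos_n by (simp add: n_eq)
  hence "\<not> pos m < pos (Suc m)" using n pos_in[of m] m by auto
  hence "\<not> snd (last (reading s))"
    using m nth_reading[of m s] by (subst last_conv_nth) (auto simp flip: length_greater_0_conv)
  moreover have "step_ok (reading s ! i) (reading s ! Suc i)" if i: "Suc i < m" for i
  proof -
    have r: "reading s ! i = (s (pos (Suc i)), pos (Suc i) < pos (Suc (Suc i)))"
        "reading s ! Suc i = (s (pos (Suc (Suc i))), pos (Suc (Suc i)) < pos (Suc (Suc (Suc i))))"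
      using nth_reading[of "Suc i" s] nth_reading[of "Suc (Suc i)" s] i by simp_all
    have "pos (Suc i) \<in> {1..n}" "pos (Suc (Suc i)) \<in> {1..n}"
      using i n by (intro pos_in; simp)+
    thus ?thesis unfolding r step_ok_def by (auto intro!: s_antimono)
  qed
  ultimately show ?thesis
    using m by (auto simp: coloured_word_iff_nth simp flip: length_greater_0_conv)
qed

text \<open>If the first letters of the two suffixes differ in value, monotonicity of \<open>s\<close> decides; if they
differ in colour only, \<open>bar_word_less\<close> decides, as bars precede plain letters.  If they coincide,
\<open>bar_word_less\<close> reduces the claim to the images under \<open>\<sigma>\<close>, that is to the next position.\<close>

lemma pos_less_if_suffix_key_less:
  assumes "p \<in> {1..n}" "q \<in> {1..n}" "suffix_key (reading s) p < suffix_key (reading s) q"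
  shows "pos p < pos q"
  using assms
proof (induction "n - p" arbitrary: p q)
  case 0
  hence p: "p = n" by auto
  hence "q \<noteq> n" using "0.prems"(3) by auto
  hence "pos q \<noteq> pos n" using pos_inj[of q n] "0.prems"(2) n by auto
  thus ?case using p pos_in[OF "0.prems"(2)] by simp
next
  case (Suc k)
  let ?u = "reading s"
  have p: "p \<in> {1..m}" using Suc.hyps(2) Suc.prems(1) n by auto
  have "q \<noteq> n" using Suc.prems(3) by (auto simp: suffix_key_reading_n)
  hence q: "q \<in> {1..m}" using Suc.prems(2) n by auto
  have ne: "pos p \<noteq> pos q" using pos_inj[of p q] Suc.prems by auto
  have in_n: "pos p \<in> {1..n}" "pos q \<in> {1..n}" "Suc p \<in> {1..n}" "Suc q \<in> {1..n}"
    using pos_in[OF Suc.prems(1)] pos_in[OF Suc.prems(2)] p q n by auto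
  have u: "?u ! (p - 1) = (s (pos p), pos p < pos (Suc p))" "?u ! (q - 1) = (s (pos q), pos q < pos (Suc q))"
    using nth_reading p q by blast+
  have "letter_key (?u ! (p - 1)) < letter_key (?u ! (q - 1)) \<or>
        ?u ! (p - 1) = ?u ! (q - 1) \<and> suffix_key ?u (Suc p) < suffix_key ?u (Suc q)"
    using Suc.prems(3) p q by (simp add: suffix_key_unfold letter_key_eq_iff del: One_nat_def)
  then consider "s (pos q) < s (pos p)"
    | "s (pos p) = s (pos q)" "pos p < pos (Suc p)" "\<not> pos q < pos (Suc q)"
    | "s (pos p) = s (pos q)" "pos p < pos (Suc p) \<longleftrightarrow> pos q < pos (Suc q)"
      "suffix_key ?u (Suc p) < suffix_key ?u (Suc q)"
    unfolding u by (auto simp: letter_key_less_iff)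
  thus ?case
  proof cases
    case 1
    show ?thesis
    proof (rule ccontr)
      assume "\<not> pos p < pos q"
      hence "s (pos p) \<le> s (pos q)" using in_n by (intro s_antimono) auto
      thus False using 1 by simp
    qed
  next
    case 2
    show ?thesis
    proof (rule ccontr)
      assume "\<not> pos p < pos q"
      hence "letter_less (bar_word n \<sigma> (pos q)) (bar_word n \<sigma> (pos p))"
        using in_n 2 ne by (intro bar_word_less) auto
      thus False using 2 Suc.prems by (simp add: bar_word_pos)
    qed
  next
    case 3
    have "pos (Suc p) < pos (Suc q)"
      using Suc.hyps(1)[of "Suc p" "Suc q"] Suc.hyps(2) in_n 3 by simp
    show ?thesis
    proof (rule ccontr)
      assume "\<not> pos p < pos q"
      hence "letter_less (bar_word n \<sigma> (pos q)) (bar_word n \<sigma> (pos p))"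
        using in_n 3 ne by (intro bar_word_less) auto
      thus False using 3 Suc.prems \<open>pos (Suc p) < pos (Suc q)\<close>
        by (simp add: bar_word_pos split: if_splits)
    qed
  qed
qed

text \<open>Hence the coloured word alone determines the positions, and with them the cycle.\<close>

lemma pos_eq_rank:
  assumes "p \<in> {1..n}"
  shows "pos p = rank_in {1..n} (suffix_key (reading s)) p"
proof (rule rank_in_eq_if_order_embedding[OF bij_pos _ _ assms, symmetric])
  show "inj_on (suffix_key (reading s)) {1..n}"
    using inj_on_suffix_key[of "reading s"] by (simp add: n_eq[symmetric])
qed (rule pos_less_if_suffix_key_less)

text \<open>The sequence decreases weakly, and \<open>N + 1\<close> is the largest of its values.\<close>

lemma s_1:
  fixes e :: "nat \<Rightarrow>\<^sub>0 nat"
  assumes e: "(\<Sum>k=1..n. Poly_Mapping.single (s k) 1) = e + Poly_Mapping.single (Suc N) 1"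
    and N: "Poly_Mapping.keys e \<subseteq> {1..N}"
  shows "s 1 = Suc N"
proof -
  have "(\<Sum>k=1..n. Poly_Mapping.single (s k) (1::nat)) = content (map s [1..<Suc n])"
    by (simp add: content_def comp_def interv_sum_list_conv_sum_set_nat atLeastLessThanSuc_atLeastAtMost
          del: upt_Suc One_nat_def)
  hence c: "content (map s [1..<Suc n]) = Poly_Mapping.single (Suc N) 1 + e"
    using e by (metis add.commute)
  have im: "s ` {1..n} = insert (Suc N) (Poly_Mapping.keys e)"
    using keys_content[of "map s [1..<Suc n]"] unfolding c keys_single_add[OF order_refl]
    by (simp add: atLeastLessThanSuc_atLeastAtMost del: upt_Suc One_nat_def)
  then obtain k where k: "k \<in> {1..n}" "s k = Suc N" by (metis imageE insertI1)
  hence "Suc N \<le> s 1" using s_antimono[of 1 k] by simp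
  moreover have "s 1 \<in> insert (Suc N) (Poly_Mapping.keys e)" unfolding im[symmetric] using n by auto
  ultimately show ?thesis using N by auto
qed

end

section \<open>Recovering the cycle from a coloured word\<close>

locale coloured_word_of_content =
  fixes m n N :: nat and e :: "nat \<Rightarrow>\<^sub>0 nat" and u :: "(nat \<times> bool) list"
  assumes n_eq: "n = Suc m" and m: "1 \<le> m" and e: "Poly_Mapping.keys e \<subseteq> {1..N}"
    and len: "length u = m" and cw: "coloured_word u" and cont: "content (map fst u) = e"
begin

(* As before, inequalities keep the simplifier from eliminating n. *)
lemma n: "m < n" "n \<le> Suc m"
  by (simp_all add: n_eq)

definition rk :: "nat \<Rightarrow> nat" where "rk = rank_in {1..n} (suffix_key u)"

lemma bij_rk: "bij_betw rk {1..n} {1..n}"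
  using bij_betw_rank_in[OF _ inj_on_suffix_key[of u]] by (simp add: rk_def len n_eq[symmetric])

lemma rk_less_iff: "p \<in> {1..n} \<Longrightarrow> q \<in> {1..n} \<Longrightarrow> rk p < rk q \<longleftrightarrow> suffix_key u p < suffix_key u q"
  unfolding rk_def by (rule rank_in_less_iff) auto

lemma suffix_key_n: "suffix_key u n = []"
  using suffix_key_end[of u] by (simp add: len n_eq[symmetric])

lemma rk_n: "rk n = 1"
proof -
  have "{q \<in> {1..n}. suffix_key u q \<le> suffix_key u n} = {n}"
    using n by (auto simp: suffix_key_n) (auto simp: suffix_key_def len)
  thus ?thesis by (simp add: rk_def rank_in_def)
qed

lemma rk_in: "p \<in> {1..n} \<Longrightarrow> rk p \<in> {1..n}"
  using bij_betw_apply[OF bij_rk] .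

lemma rk_surj: assumes "i \<in> {1..n}" obtains p where "p \<in> {1..n}" "i = rk p"
  using assms bij_betw_imp_surj_on[OF bij_rk] by blast

lemma rk_eq_iff: "p \<in> {1..n} \<Longrightarrow> q \<in> {1..n} \<Longrightarrow> rk p = rk q \<longleftrightarrow> p = q"
  using bij_rk by (auto simp: bij_betw_def dest: inj_onD)

definition next_pos :: "nat \<Rightarrow> nat" where "next_pos p = (if p = n then 1 else Suc p)"

lemma bij_next_pos: "bij_betw next_pos {1..n} {1..n}"
  by (rule bij_betw_byWitness[of _ "\<lambda>p. if p = 1 then n else p - 1"])
     (use n in \<open>auto simp: next_pos_def split: if_splits\<close>)

definition rk_inv :: "nat \<Rightarrow> nat" where "rk_inv = inv_into {1..n} rk"

lemma rk_inv_rk: "p \<in> {1..n} \<Longrightarrow> rk_inv (rk p) = p"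
  unfolding rk_inv_def by (rule inv_into_f_f[OF bij_betw_imp_inj_on[OF bij_rk]])

definition label_cycle :: "nat \<Rightarrow> nat" where
  "label_cycle i = (if i \<in> {1..n} then rk (next_pos (rk_inv i)) else i)"

text \<open>The position \<open>1\<close> belongs to the largest letter \<open>N + 1\<close>, which the coloured word omits.  Outside
\<open>[n]\<close> the value is the one that extensional functions take.\<close>

definition labels :: "nat \<Rightarrow> nat" where
  "labels i = (if i \<in> {1..n} then if i = 1 then Suc N else fst (u ! (rk_inv i - 1)) else undefined)"

lemma label_cycle_rk: "p \<in> {1..n} \<Longrightarrow> label_cycle (rk p) = rk (next_pos p)"
  using rk_in by (simp add: label_cycle_def rk_inv_rk)

lemma label_cycle_permutes: "label_cycle permutes {1..n}"
proof (rule bij_imp_permutes)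
  have "bij_betw rk_inv {1..n} {1..n}" unfolding rk_inv_def by (rule bij_betw_inv_into[OF bij_rk])
  hence "bij_betw (rk \<circ> (next_pos \<circ> rk_inv)) {1..n} {1..n}"
    using bij_next_pos bij_rk by (intro bij_betw_trans)
  thus "bij_betw label_cycle {1..n} {1..n}"
    by (subst bij_betw_cong[where g = "rk \<circ> (next_pos \<circ> rk_inv)"]) (auto simp: label_cycle_def)
qed (auto simp: label_cycle_def)

lemma funpow_label_cycle: "p \<in> {1..n} \<Longrightarrow> (label_cycle ^^ p) 1 = rk p"
proof (induction p)
  case (Suc p)
  show ?case
  proof (cases "p = 0")
    case True
    have "label_cycle (rk n) = rk (next_pos n)" using n by (intro label_cycle_rk) auto
    thus ?thesis using True by (simp add: rk_n next_pos_def)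
  next
    case False
    hence p: "p \<in> {1..n}" using Suc.prems by auto
    have "next_pos p = Suc p" using Suc.prems by (auto simp: next_pos_def)
    thus ?thesis using Suc.IH[OF p] label_cycle_rk[OF p] by simp
  qed
qed simp

lemma cyclic_label_cycle: "cyclic_on label_cycle {1..n}"
proof -
  have o: "{1..n} = orbit label_cycle 1"
  proof (intro equalityI subsetI)
    fix i assume "i \<in> {1..n}"
    then obtain p where p: "p \<in> {1..n}" "i = rk p" by (rule rk_surj)
    hence "i = (label_cycle ^^ p) 1" "0 < p" using funpow_label_cycle[of p] by auto
    thus "i \<in> orbit label_cycle 1" unfolding orbit_altdef by blast
  next
    fix i assume "i \<in> orbit label_cycle 1"
    thus "i \<in> {1..n}" using permutes_orbit_subset[OF label_cycle_permutes, of 1] n by auto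
  qed
  have "1 \<in> {1..n}" using n by simp
  thus ?thesis unfolding cyclic_on_def using o by blast
qed

sublocale cycle_reading m n label_cycle
  using n_eq m label_cycle_permutes cyclic_label_cycle by unfold_locales

lemma pos_eq: "p \<in> {1..n} \<Longrightarrow> pos p = rk p"
  unfolding pos_def by (rule funpow_label_cycle)

lemma labels_rk: "p \<in> {1..m} \<Longrightarrow> labels (rk p) = fst (u ! (p - 1))"
proof -
  assume p: "p \<in> {1..m}"
  hence "rk p \<noteq> rk n" using n by (subst rk_eq_iff) auto
  thus ?thesis using p n rk_in[of p] by (simp add: labels_def rk_inv_rk rk_n)
qed

lemma labels_1: "labels 1 = Suc N"
  using n by (simp add: labels_def)

lemma u_step:
  assumes "p \<in> {1..<m}"
  shows "step_ok (u ! (p - 1)) (u ! p)"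
  using cw assms len by (cases p) (auto simp: coloured_word_iff_nth)

text \<open>Compare two consecutive suffixes from the right.  A bar announces that the next letter is weakly
smaller, so its suffix comes later; on a plateau the colour of the next letter decides in the same
way.\<close>

lemma snd_u_iff: "p \<in> {1..m} \<Longrightarrow> snd (u ! (p - 1)) \<longleftrightarrow> suffix_key u p < suffix_key u (Suc p)"
proof (induction "m - p" arbitrary: p)
  case 0
  hence p: "p = m" by simp
  have "u \<noteq> []" using len m by auto
  hence "\<not> snd (u ! (p - 1))" using cw by (simp add: coloured_word_iff_nth last_conv_nth len p)
  moreover have "suffix_key u (Suc p) = []" using suffix_key_n by (simp add: n_eq p)
  ultimately show ?case by simp
next
  case (Suc k)
  hence p: "p \<in> {1..<m}" by auto
  have IH: "snd (u ! p) \<longleftrightarrow> suffix_key u (Suc p) < suffix_key u (Suc (Suc p))"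
    using Suc.hyps(1)[of "Suc p"] Suc.hyps(2) p by simp
  have keys: "suffix_key u p = letter_key (u ! (p - 1)) # suffix_key u (Suc p)"
    "suffix_key u (Suc p) = letter_key (u ! p) # suffix_key u (Suc (Suc p))"
    using suffix_key_unfold[of p u] suffix_key_unfold[of "Suc p" u] p len by simp_all
  have "suffix_key u p < suffix_key u (Suc p) \<longleftrightarrow>
      letter_key (u ! (p - 1)) < letter_key (u ! p) \<or>
      u ! (p - 1) = u ! p \<and> suffix_key u (Suc p) < suffix_key u (Suc (Suc p))"
    by (subst keys(1), subst keys(2)) (simp add: letter_key_eq_iff)
  also have "\<dots> \<longleftrightarrow> snd (u ! (p - 1))"
    using u_step[OF p] unfolding letter_key_less_iff IH[symmetric] step_ok_def
    by (auto simp: prod_eq_iff split: if_splits)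
  finally show ?case ..
qed

lemma pos_less_iff: "p \<in> {1..m} \<Longrightarrow> pos p < pos (Suc p) \<longleftrightarrow> snd (u ! (p - 1))"
  using n by (simp add: snd_u_iff pos_eq rk_less_iff del: One_nat_def)

lemma reading_labels: "reading labels = u"
proof (rule nth_equalityI)
  fix i assume "i < length (reading labels)"
  hence i: "Suc i \<in> {1..m}" by simp
  hence "pos (Suc i) = rk (Suc i)" using n by (intro pos_eq) auto
  thus "reading labels ! i = u ! i"
    using nth_reading[OF i, of labels] labels_rk[OF i] pos_less_iff[OF i] by (simp add: prod_eq_iff)
qed (simp add: len)

lemma u_letters: "p \<in> {1..m} \<Longrightarrow> fst (u ! (p - 1)) \<in> {1..N}"
proof -
  assume "p \<in> {1..m}"
  hence "u ! (p - 1) \<in> set u" using len by (intro nth_mem) auto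
  hence "fst (u ! (p - 1)) \<in> set (map fst u)" by simp
  thus ?thesis using e unfolding cont[symmetric] keys_content by blast
qed

text \<open>Equal labels at consecutive positions \<open>k\<close> and \<open>k + 1\<close> mean that only the first of the two letters
is barred, or that the colours agree and the next suffixes increase.  In both cases the barred word increases at \<open>k\<close>, so \<open>k\<close> is not
in \<^const>\<open>DEX\<close>.\<close>

lemma labels_step:
  assumes k: "k \<in> {1..<n}"
  shows "labels (Suc k) \<le> labels k" "k \<in> DEX n label_cycle \<Longrightarrow> labels (Suc k) < labels k"
proof -
  obtain p where p: "p \<in> {1..n}" "k = rk p" using k by (auto intro: rk_surj[of k])
  obtain q where q: "q \<in> {1..n}" "Suc k = rk q" using k by (auto intro: rk_surj[of "Suc k"])
  have less: "suffix_key u p < suffix_key u q" using p q by (simp flip: rk_less_iff)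
  hence "q \<noteq> n" by (auto simp: suffix_key_n)
  hence q': "q \<in> {1..m}" using q n by auto
  have "labels (Suc k) \<le> labels k \<and> (k \<in> DEX n label_cycle \<longrightarrow> labels (Suc k) < labels k)"
  proof (cases "p = n")
    case True
    thus ?thesis using p q q' u_letters[OF q'] labels_1 by (simp add: rk_n labels_rk)
  next
    case False
    hence p': "p \<in> {1..m}" using p n by auto
    have S: "Suc p \<in> {1..n}" "Suc q \<in> {1..n}" using p' q' n by auto
    have L: "labels k = fst (u ! (p - 1))" "labels (Suc k) = fst (u ! (q - 1))"
      using p q p' q' by (simp_all add: labels_rk)
    have B1: "bar_word n label_cycle k = (if snd (u ! (p - 1)) then Bar (rk (Suc p)) else Plain (rk (Suc p)))"
      using bar_word_pos[OF p(1)] unfolding p(2) pos_less_iff[OF p'] unfolding pos_eq[OF p(1)] pos_eq[OF S(1)] .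
    have B2: "bar_word n label_cycle (Suc k) = (if snd (u ! (q - 1)) then Bar (rk (Suc q)) else Plain (rk (Suc q)))"
      using bar_word_pos[OF q(1)] unfolding q(2) pos_less_iff[OF q'] unfolding pos_eq[OF q(1)] pos_eq[OF S(2)] .
    have "letter_key (u ! (p - 1)) < letter_key (u ! (q - 1)) \<or>
        u ! (p - 1) = u ! (q - 1) \<and> suffix_key u (Suc p) < suffix_key u (Suc q)"
      using less p' q' len by (simp add: suffix_key_unfold letter_key_eq_iff del: One_nat_def)
    thus ?thesis
      unfolding L rk_less_iff[OF S, symmetric] letter_key_less_iff by (auto simp: DEX_def B1 B2)
  qed
  thus "labels (Suc k) \<le> labels k" "k \<in> DEX n label_cycle \<Longrightarrow> labels (Suc k) < labels k" by auto
qed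

lemma labels_fund_seqs: "labels \<in> fund_seqs (DEX n label_cycle) n"
proof -
  have "labels i \<ge> 1" if i: "i \<in> {1..n}" for i
  proof -
    obtain p where p: "p \<in> {1..n}" "i = rk p" using i by (rule rk_surj)
    show ?thesis
    proof (cases "p = n")
      case True thus ?thesis using p labels_1 rk_n by simp
    next
      case False
      hence "p \<in> {1..m}" using p n by auto
      thus ?thesis using u_letters[of p] labels_rk[of p] p by simp
    qed
  qed
  moreover have "DEX n label_cycle \<subseteq> {1..<n}" by (auto simp: DEX_def)
  ultimately show ?thesis
    using labels_step by (auto simp: fund_seqs_def labels_def[abs_def])
qed

end

text \<open>Reading is a bijection from the pairs counted on the left to the coloured words with one bar less
than there are excedances: \<open>pos_eq_rank\<close> gives injectivity and \<open>reading_labels\<close> surjectivity.\<close>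

lemma Q_cycle_eq_coloured_words:
  assumes m: "1 \<le> m" and e: "Poly_Mapping.keys e \<subseteq> {1..N}"
  shows "Q_cycle (Suc m) j (e + Poly_Mapping.single (Suc N) 1) =
    (if j = 0 then 0 else of_nat (card (coloured_words m e (j - 1))))"
proof -
  define n where "n = Suc m"
  let ?e = "e + Poly_Mapping.single (Suc N) (1::nat)"
  define C where "C = {\<sigma>. \<sigma> permutes {1..n} \<and> cyclic_on \<sigma> {1..n} \<and> exc n \<sigma> = j}"
  define F where "F \<sigma> = {s \<in> fund_seqs (DEX n \<sigma>) n. (\<Sum>k=1..n. Poly_Mapping.single (s k) 1) = ?e}" for \<sigma>
  have finC: "finite C"
    unfolding C_def by (rule finite_subset[OF _ finite_permutations[of "{1..n}"]]) auto
  have finF: "finite (F \<sigma>)" for \<sigma> unfolding F_def by (rule finite_fund_qsym_index)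
  define \<Phi> where "\<Phi> = (\<lambda>(\<sigma>, s). cycle_reading.reading n \<sigma> s)"
  have loc: "cycle_seq m n \<sigma> s" if "\<sigma> \<in> C" "s \<in> F \<sigma>" for \<sigma> s
    using that m by (unfold_locales) (auto simp: C_def F_def n_def)
  have inj: "inj_on \<Phi> (Sigma C F)"
  proof (rule inj_onI, clarify)
    fix \<sigma> s \<sigma>' s' assume A: "\<sigma> \<in> C" "s \<in> F \<sigma>" "\<sigma>' \<in> C" "s' \<in> F \<sigma>'" "\<Phi> (\<sigma>, s) = \<Phi> (\<sigma>', s')"
    interpret a: cycle_seq m n \<sigma> s using A by (intro loc)
    interpret b: cycle_seq m n \<sigma>' s' using A by (intro loc)
    have eq: "a.reading s = b.reading s'" using A(5) by (simp add: \<Phi>_def)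
    have pos: "a.pos p = b.pos p" if "p \<in> {1..n}" for p
      using that by (simp only: a.pos_eq_rank b.pos_eq_rank eq)
    have "\<sigma> i = \<sigma>' i" for i
    proof (cases "i \<in> {1..n}")
      case True
      then obtain p where p: "p \<in> {1..n}" "i = a.pos p" by (rule a.pos_surj)
      have "\<exists>q\<in>{1..n}. a.pos (Suc p) = a.pos q \<and> b.pos (Suc p) = b.pos q"
      proof (cases "p = n")
        case True
        have "a.pos (Suc n) = a.pos 1" "b.pos (Suc n) = b.pos 1"
          unfolding a.pos_eq_iff b.pos_eq_iff by (simp_all add: mod_Suc)
        thus ?thesis using True n_def by (intro bexI[of _ 1]) auto
      next
        case False
        thus ?thesis using p by (intro bexI[of _ "Suc p"]) auto
      qed
      hence "a.pos (Suc p) = b.pos (Suc p)" using pos by auto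
      thus ?thesis using p pos[OF p(1)] by (simp add: a.pos_Suc b.pos_Suc)
    next
      case False
      thus ?thesis using a.perm b.perm by (simp add: permutes_not_in)
    qed
    hence \<sigma>: "\<sigma> = \<sigma>'" by auto
    have sums: "(\<Sum>k=1..n. Poly_Mapping.single (s k) 1) = ?e" "(\<Sum>k=1..n. Poly_Mapping.single (s' k) 1) = ?e"
      using A(2,4) unfolding F_def by blast+
    have s1: "s 1 = Suc N" "s' 1 = Suc N"
      using a.s_1[OF sums(1) e] b.s_1[OF sums(2) e] .
    have "s i = s' i" for i
    proof (cases "i \<in> {1..n}")
      case True
      then obtain p where p: "p \<in> {1..n}" "i = a.pos p" by (rule a.pos_surj)
      show ?thesis
      proof (cases "p = n")
        case True
        thus ?thesis using p s1 by simp
      next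
        case False
        hence p': "p \<in> {1..m}" using p n_def by auto
        have "s (a.pos p) = s' (b.pos p)"
          using a.nth_reading[OF p', of s] b.nth_reading[OF p', of s'] eq by simp
        thus ?thesis using p pos by simp
      qed
    next
      case False
      thus ?thesis using a.s b.s by (auto simp: fund_seqs_def PiE_def extensional_def)
    qed
    thus "\<sigma> = \<sigma>' \<and> s = s'" using \<sigma> by auto
  qed
  have img: "\<Phi> ` Sigma C F = (if j = 0 then {} else coloured_words m e (j - 1))"
  proof (intro equalityI subsetI)
    fix u assume "u \<in> \<Phi> ` Sigma C F"
    then obtain \<sigma> s where A: "\<sigma> \<in> C" "s \<in> F \<sigma>" and u: "u = \<Phi> (\<sigma>, s)" by auto
    interpret a: cycle_seq m n \<sigma> s using A by (intro loc)
    have u: "u = a.reading s" using u by (simp add: \<Phi>_def)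
    have sum: "(\<Sum>k=1..n. Poly_Mapping.single (s k) 1) = ?e" using A by (simp add: F_def)
    have "content (map fst u) + Poly_Mapping.single (Suc N) 1 = ?e"
      using a.content_reading[of s] sum a.s_1[OF sum e] by (simp add: u)
    hence "content (map fst u) = e" by simp
    moreover have "j = Suc (bars u)" using a.exc_eq[of s] A by (simp add: C_def u)
    ultimately show "u \<in> (if j = 0 then {} else coloured_words m e (j - 1))"
      using a.coloured_word_reading by (simp add: coloured_words_def u)
  next
    fix u assume "u \<in> (if j = 0 then {} else coloured_words m e (j - 1))"
    hence j: "j = Suc (bars u)" and u: "length u = m" "coloured_word u" "content (map fst u) = e"
      by (auto simp: coloured_words_def split: if_splits)
    interpret a: coloured_word_of_content m n N e u using u m e by unfold_locales (simp_all add: n_def)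
    have "a.label_cycle \<in> C"
      using a.label_cycle_permutes a.cyclic_label_cycle a.exc_eq[of a.labels] j by (simp add: C_def a.reading_labels)
    moreover have "a.labels \<in> F a.label_cycle"
      using a.labels_fund_seqs a.content_reading[of a.labels] u(3)
      by (simp add: F_def a.reading_labels a.labels_1 del: One_nat_def)
    moreover have "\<Phi> (a.label_cycle, a.labels) = u" by (simp add: \<Phi>_def a.reading_labels)
    ultimately show "u \<in> \<Phi> ` Sigma C F" by force
  qed
  have "Q_cycle n j ?e = of_nat (\<Sum>\<sigma>\<in>C. card (F \<sigma>))"
    by (simp add: Q_cycle_def fund_qsym_def C_def F_def)
  also have "(\<Sum>\<sigma>\<in>C. card (F \<sigma>)) = card (Sigma C F)"
    using finC finF by simp
  also have "\<dots> = card (\<Phi> ` Sigma C F)" by (rule card_image[OF inj, symmetric])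
  finally show ?thesis by (simp add: img n_def)
qed

section \<open>Character values at permutations with a fixed point\<close>

lemma q_int_1 [simp]: "q_int 1 = 1"
  by (simp add: q_int_def monom_eq_1)

lemma coeff_Q_cycle:
  assumes m: "1 \<le> m" and e: "Poly_Mapping.keys e \<subseteq> {1..N}"
  shows "Q_cycle (Suc m) j (e + Poly_Mapping.single (Suc N) 1) =
    (\<Sum>\<nu> | is_partition m \<nu>. of_int (poly.coeff
        (monom 1 1 * eulerian_poly (length \<nu>) * prod_list (map q_int \<nu>)) j) /
      of_nat (z_partition \<nu>) * power_sum_partition \<nu> e)"
proof (cases "j = 0")
  case True
  thus ?thesis
    unfolding Q_cycle_eq_coloured_words[OF m e] by (simp add: mult.assoc coeff_monom_mult)
next
  case False
  have "Q_cycle (Suc m) j (e + Poly_Mapping.single (Suc N) 1) =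
      of_int (poly.coeff (\<Sum>w | w \<in> words N m \<and> content w = e. word_poly w) (j - 1))"
    using False unfolding Q_cycle_eq_coloured_words[OF m e] coeff_sum_word_poly[OF m e] by simp
  also have "\<dots> = (\<Sum>\<nu> | is_partition m \<nu>. power_sum_partition \<nu> e / of_nat (z_partition \<nu>) *
       of_int (poly.coeff (eulerian_poly (length \<nu>) * prod_list (map q_int \<nu>)) (j - 1)))"
    by (rule sum_word_poly_coeff[OF m e])
  also have "\<dots> = (\<Sum>\<nu> | is_partition m \<nu>. of_int (poly.coeff
        (monom 1 1 * eulerian_poly (length \<nu>) * prod_list (map q_int \<nu>)) j) /
      of_nat (z_partition \<nu>) * power_sum_partition \<nu> e)"
    using False by (intro sum.cong refl) (simp add: mult.assoc coeff_monom_mult)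
  finally show ?thesis .
qed

text \<open>The operator \<open>\<partial>/\<partial>p\<^sub>1\<close> multiplies \<open>p\<^sub>\<mu>\<close> by the number of ones in \<open>\<mu>\<close>, which is the factor by which
\<open>z\<^sub>\<mu>\<close> exceeds \<open>z\<^sub>\<nu>\<close> for \<open>\<mu> = \<nu> @ [1]\<close>.\<close>

lemma coeff_frobenius_ch:
  assumes e: "Poly_Mapping.keys e \<subseteq> {1..N}"
  shows "frobenius_ch (Suc m) V (e + Poly_Mapping.single (Suc N) 1) =
    (\<Sum>\<nu> | is_partition m \<nu>. character_at_type (Suc m) V (\<nu> @ [1]) /
       of_nat (z_partition \<nu>) * power_sum_partition \<nu> e)"
proof -
  let ?e = "e + Poly_Mapping.single (Suc N) (1::nat)"
  let ?t = "\<lambda>\<mu>. inverse (of_nat (z_partition \<mu>)) * character_at_type (Suc m) V \<mu> * power_sum_partition \<mu> ?e"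
  have p: "power_sum_partition \<mu> ?e = of_nat (count_list \<mu> 1) * power_sum_partition (remove1 1 \<mu>) e"
    if "is_partition k \<mu>" for k \<mu>
    using that e by (intro power_sum_partition_new_variable) (auto simp: is_partition_def)
  have "frobenius_ch (Suc m) V ?e = (\<Sum>\<mu> | is_partition (Suc m) \<mu>. ?t \<mu>)"
    by (simp add: frobenius_ch_def)
  also have "\<dots> = (\<Sum>\<mu> | is_partition (Suc m) \<mu> \<and> 1 \<in> set \<mu>. ?t \<mu>)"
    by (rule sum.mono_neutral_right[OF finite_partitions])
       (auto simp: p count_list_0_iff simp del: One_nat_def)
  also have "\<dots> = (\<Sum>\<nu> | is_partition m \<nu>. ?t (\<nu> @ [1]))"
  proof (rule sum.reindex_bij_betw[symmetric])
    show "bij_betw (\<lambda>\<nu>. \<nu> @ [1]) {\<nu>. is_partition m \<nu>} {\<mu>. is_partition (Suc m) \<mu> \<and> 1 \<in> set \<mu>}"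
      by (rule bij_betw_imageI)
         (auto simp: inj_on_def is_partition_snoc_1 simp del: One_nat_def elim!: is_partition_with_1)
  qed
  also have "\<dots> = (\<Sum>\<nu> | is_partition m \<nu>. character_at_type (Suc m) V (\<nu> @ [1]) /
       of_nat (z_partition \<nu>) * power_sum_partition \<nu> e)"
  proof (intro sum.cong refl)
    fix \<nu> assume "\<nu> \<in> {\<nu>. is_partition m \<nu>}"
    hence \<nu>: "is_partition m \<nu>" and pos: "\<forall>l\<in>set \<nu>. 1 \<le> l" by (auto simp: is_partition_def)
    define c where "c = of_nat (count_list \<nu> 1 + 1) * (1 :: complex)"
    have c: "c \<noteq> 0" unfolding c_def by (simp del: of_nat_Suc of_nat_add)
    have z: "(of_nat (z_partition \<nu>) :: complex) \<noteq> 0" using z_partition_pos[OF pos] by simp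
    have "power_sum_partition (remove1 1 (\<nu> @ [1])) = power_sum_partition \<nu>"
      by (rule power_sum_partition_mset_cong[symmetric, OF pos]) simp
    hence "power_sum_partition (\<nu> @ [1]) ?e = c * power_sum_partition \<nu> e"
      using p[of "Suc m" "\<nu> @ [1]"] \<nu> by (simp add: is_partition_snoc_1 c_def del: One_nat_def)
    moreover have "of_nat (z_partition (\<nu> @ [1])) = c * of_nat (z_partition \<nu>)"
      unfolding z_partition_snoc_1 c_def by (simp add: algebra_simps)
    ultimately show "?t (\<nu> @ [1]) = character_at_type (Suc m) V (\<nu> @ [1]) /
       of_nat (z_partition \<nu>) * power_sum_partition \<nu> e"
      using c z by (simp add: field_simps del: One_nat_def)
  qed
  finally show ?thesis .
qed

theorem corollary6p8:
  fixes n j :: nat and lam :: "nat list" and \<sigma> :: "nat \<Rightarrow> nat" and V :: virtual_rep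
  assumes "n \<ge> 2"
    and "is_partition n lam" and "last lam = 1"
    and "\<sigma> permutes {1..n}" and "cycle_type n \<sigma> = mset lam"
    and "is_virtual_rep n V" and "frobenius_ch n V = Q_cycle n j"
  shows "character V \<sigma> =
    of_int (Polynomial.coeff
      (Polynomial.monom 1 1 * eulerian_poly (length lam - 1) * (\<Prod>i<length lam. q_int (lam ! i))) j)"
proof -
  define m where "m = n - 1"
  have n: "n = Suc m" and m: "1 \<le> m" using assms(1) by (simp_all add: m_def)
  have "lam \<noteq> []" using assms(1,2) by (auto simp: is_partition_def)
  hence "1 \<in> set lam" using assms(3) by (metis last_in_set)
  then obtain \<nu>\<^sub>0 where lam: "lam = \<nu>\<^sub>0 @ [1]" and \<nu>\<^sub>0: "is_partition m \<nu>\<^sub>0"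
    using assms(2) is_partition_with_1 unfolding n by metis
  define \<phi> where "\<phi> \<nu> = (of_int (poly.coeff
     (monom 1 1 * eulerian_poly (length \<nu>) * prod_list (map q_int \<nu>)) j) :: complex)" for \<nu>
  \<comment> \<open>The difference of the two expansions, coefficient by coefficient.\<close>
  define d where "d \<nu> = (character_at_type n V (\<nu> @ [1]) - \<phi> \<nu>) / of_nat (z_partition \<nu>)" for \<nu>
  have "d \<nu>\<^sub>0 = 0"
  proof (rule power_sums_linearly_independent[OF _ \<nu>\<^sub>0])
    fix e :: "nat \<Rightarrow>\<^sub>0 nat" assume e0: "0 \<notin> Poly_Mapping.keys e"
    define N where "N = Max (insert 0 (Poly_Mapping.keys e))"
    have e: "Poly_Mapping.keys e \<subseteq> {1..N}"
    proof
      fix i assume i: "i \<in> Poly_Mapping.keys e"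
      hence "i \<noteq> 0" using e0 by metis
      thus "i \<in> {1..N}" using i by (simp add: N_def)
    qed
    have "(\<Sum>\<nu> | is_partition m \<nu>. character_at_type n V (\<nu> @ [1]) / of_nat (z_partition \<nu>) * power_sum_partition \<nu> e) =
          (\<Sum>\<nu> | is_partition m \<nu>. \<phi> \<nu> / of_nat (z_partition \<nu>) * power_sum_partition \<nu> e)"
      using coeff_frobenius_ch[OF e, of m V] coeff_Q_cycle[OF m e, of j] assms(7)
      unfolding \<phi>_def n by simp
    thus "(\<Sum>\<nu> | is_partition m \<nu>. d \<nu> * power_sum_partition \<nu> e) = 0"
      by (simp add: d_def diff_divide_distrib left_diff_distrib sum_subtractf)
  qed
  moreover have "z_partition \<nu>\<^sub>0 > 0" using \<nu>\<^sub>0 by (intro z_partition_pos) (simp add: is_partition_def)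
  ultimately have "character_at_type n V lam = \<phi> \<nu>\<^sub>0" by (simp add: d_def lam)
  moreover have "character V \<sigma> = character_at_type n V lam"
    by (rule character_eq_character_at_type[OF assms(6,4,5)])
  moreover have "(\<Prod>i<length lam. q_int (lam ! i)) = prod_list (map q_int lam)"
    by (simp add: prod.list_conv_set_nth atLeast0LessThan)
  hence "(\<Prod>i<length lam. q_int (lam ! i)) = prod_list (map q_int \<nu>\<^sub>0)" by (simp add: lam del: One_nat_def)
  ultimately show ?thesis by (simp add: \<phi>_def lam del: One_nat_def)
qed

end
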